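(* Let $f:\subseteq \mathbb{N}^\mathbb{N} \rightrightarrows \mathbb{N}^\mathbb{N}$ be a partial multivalued function. The following are equivalent: (1) The first-order part ${}^1(f)$ of $f$ is discontinuous. (2) There exists a convergent sequence $(a_n)_{n\in\mathbb{N}}$ in $\mathbb{N}^\mathbb{N}$ with $\overline{\{a_n \mid n\in\mathbb{N}\}}\subseteq \operatorname{dom}(f)$ such that the restriction $f|_{\overline{\{a_n \mid n \in \mathbb{N}\}}}$ is discontinuous. (3) $\mathsf{ACC}_{\mathbb{N}} \leq_{\mathrm{W}}^* f$.
   Context: A multivalued function $g:\subseteq \mathbf{X}\rightrightarrows \mathbf{Y}$ between represented spaces is continuous iff it has a continuous realizer, i.e. a continuous partial map $G$ on names such that $G(p)$ is a name of an element of $g(x)$ whenever $p$ is a name of $x\in\operatorname{dom}(g)$ (for $\mathbb{N}^\mathbb{N}$ and $\mathbb{N}$ the names are the points themselves). Weihrauch reducibility $g\leq_{\mathrm{W}} h$: there are computable $H,K$ such that for every realizer $G$ of $h$, the map $p\mapsto K(p,G(H(p)))$ realizes $g$; continuous Weihrauch reducibility $g\leq_{\mathrm{W}}^* h$ is the same with $H,K$ only required to be continuous. The first-order part is ${}^1(f):=\max_{\leq_{\mathrm{W}}}\{g:\subseteq \mathbb{N}^\mathbb{N}\rightrightarrows \mathbb{N} \mid g\leq_{\mathrm{W}} f\}$ (this maximum exists). $\mathsf{ACC}_{\mathbb{N}}$ is the problem: given an enumeration of a set $U\subseteq\mathbb{N}$ with $|U|\le 1$, output some element of $\mathbb{N}\setminus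 U$ (equivalently, the restriction of $\mathrm{C}_\mathbb{N}$ to sets $A\subseteq\mathbb{N}$ with $|\mathbb{N}\setminus A|\le 1$, where $A$ is given by an enumeration of its complement). *)

theory Defs
  imports "HOL-Analysis.Function_Topology" "HOL-Library.Sublist" "HOL-Library.Nat_Bijection"
begin

type_synonym baire = "nat \<Rightarrow> nat"

text \<open>A partial multivalued function is a set-valued function; it is undefined exactly where its
  value is the empty set.\<close>

type_synonym ('x, 'y) mvfun = "'x \<Rightarrow> 'y set"

definition mv_dom :: "('x, 'y) mvfun \<Rightarrow> 'x set" where
  "mv_dom g = {x. g x \<noteq> {}}"

definition mv_restrict :: "('x, 'y) mvfun \<Rightarrow> 'x set \<Rightarrow> ('x, 'y) mvfun" where
  "mv_restrict g S = (\<lambda>x. if x \<in> S then g x else {})"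

type_synonym 'x representation = "baire \<rightharpoonup> 'x"

definition baire_rep :: "baire representation" where
  "baire_rep p = Some p"

text \<open>Since names are elements of Baire space, a name of a number \<open>n\<close> is a sequence with first
  entry \<open>n\<close>. The lemma \<open>mv_continuous_baire_nat_iff\<close> below shows that, for continuity, this is the
  same as using the numbers as names of themselves.\<close>

definition nat_rep :: "nat representation" where
  "nat_rep p = Some (p 0)"

text \<open>Sets given by an enumeration: \<open>Suc n\<close> lists the element \<open>n\<close>, and \<open>0\<close> lists nothing, so that
  the empty set has a name as well.\<close>

definition enum_rep :: "nat set representation" where
  "enum_rep p = Some {n. \<exists>k. p k = Suc n}"

definition realizes ::
  "'x representation \<Rightarrow> 'y representation \<Rightarrow> (baire \<rightharpoonup> baire) \<Rightarrow> ('x, 'y) mvfun \<Rightarrow> bool" where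
  "realizes dX dY G g \<longleftrightarrow>
     (\<forall>p x. dX p = Some x \<and> x \<in> mv_dom g \<longrightarrow>
        (\<exists>q y. G p = Some q \<and> dY q = Some y \<and> y \<in> g x))"

definition continuous_partial :: "('a::topological_space \<rightharpoonup> 'b::topological_space) \<Rightarrow> bool" where
  "continuous_partial F \<longleftrightarrow> continuous_on (dom F) (\<lambda>x. the (F x))"

definition mv_continuous ::
  "'x representation \<Rightarrow> 'y representation \<Rightarrow> ('x, 'y) mvfun \<Rightarrow> bool" where
  "mv_continuous dX dY g \<longleftrightarrow> (\<exists>G. continuous_partial G \<and> realizes dX dY G g)"

lemma mv_continuous_baire_nat_iff:
  "mv_continuous baire_rep nat_rep g \<longleftrightarrow>
     (\<exists>G :: baire \<rightharpoonup> nat. continuous_partial G \<and> (\<forall>p\<in>mv_dom g. \<exists>n. G p = Some n \<and> n \<in> g p))"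
proof
  assume "mv_continuous baire_rep nat_rep g"
  then obtain G where G: "continuous_partial G" "realizes baire_rep nat_rep G g"
    unfolding mv_continuous_def by blast
  define F where "F = (\<lambda>p. map_option (\<lambda>q. q (0::nat)) (G p))"
  have dom: "dom F = dom G"
    by (auto simp: F_def dom_def)
  have "continuous_on (dom G) (\<lambda>p. the (G p) 0)"
    using G(1) unfolding continuous_partial_def by (rule continuous_on_product_then_coordinatewise)
  then have "continuous_partial F"
    unfolding continuous_partial_def dom
    by (rule continuous_on_eq) (auto simp: F_def)
  moreover have "\<forall>p\<in>mv_dom g. \<exists>n. F p = Some n \<and> n \<in> g p"
    using G(2) by (fastforce simp: realizes_def baire_rep_def nat_rep_def F_def)
  ultimately show "\<exists>G :: baire \<rightharpoonup> nat. continuous_partial G \<and>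
      (\<forall>p\<in>mv_dom g. \<exists>n. G p = Some n \<and> n \<in> g p)"
    by blast
next
  assume "\<exists>G :: baire \<rightharpoonup> nat. continuous_partial G \<and>
      (\<forall>p\<in>mv_dom g. \<exists>n. G p = Some n \<and> n \<in> g p)"
  then obtain G :: "baire \<rightharpoonup> nat" where
    G: "continuous_partial G" "\<forall>p\<in>mv_dom g. \<exists>n. G p = Some n \<and> n \<in> g p"
    by blast
  define F :: "baire \<rightharpoonup> baire" where "F = (\<lambda>p. map_option (\<lambda>n _. n) (G p))"
  have dom: "dom F = dom G"
    by (auto simp: F_def dom_def)
  have "continuous_on (dom G) (\<lambda>p (i::nat). the (G p))"
    using G(1) unfolding continuous_partial_def
    by (intro continuous_on_coordinatewise_then_product)
  then have "continuous_partial F"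
    unfolding continuous_partial_def dom
    by (rule continuous_on_eq) (auto simp: F_def)
  moreover have "realizes baire_rep nat_rep F g"
    using G(2) by (fastforce simp: realizes_def baire_rep_def nat_rep_def F_def)
  ultimately show "mv_continuous baire_rep nat_rep g"
    unfolding mv_continuous_def by blast
qed

text \<open>Kleene's general recursive functions of a given arity: the primitive recursive schemes
  together with minimization of regular functions. Only the values on lists of length \<open>n\<close> are
  meaningful.\<close>

inductive total_recursive :: "nat \<Rightarrow> (nat list \<Rightarrow> nat) \<Rightarrow> bool" where
  zero: "total_recursive n (\<lambda>_. 0)"
| succ: "total_recursive 1 (\<lambda>xs. Suc (hd xs))"
| proj: "i < n \<Longrightarrow> total_recursive n (\<lambda>xs. xs ! i)"
| comp: "total_recursive (length gs) f \<Longrightarrow> (\<And>g. g \<in> set gs \<Longrightarrow> total_recursive n g) \<Longrightarrow>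
     total_recursive n (\<lambda>xs. f (map (\<lambda>g. g xs) gs))"
| prec: "total_recursive n f \<Longrightarrow> total_recursive (Suc (Suc n)) g \<Longrightarrow>
     total_recursive (Suc n) (\<lambda>xs. rec_nat (f (tl xs)) (\<lambda>y r. g (y # r # tl xs)) (hd xs))"
| mu: "total_recursive (Suc n) f \<Longrightarrow>
     (\<And>xs. length xs = n \<Longrightarrow> \<exists>y. f (y # xs) = 0) \<Longrightarrow>
     total_recursive n (\<lambda>xs. LEAST y. f (y # xs) = 0)"

definition recursive_word_fun :: "(nat list \<Rightarrow> nat list) \<Rightarrow> bool" where
  "recursive_word_fun h \<longleftrightarrow>
     (\<exists>r. total_recursive 1 r \<and> (\<forall>w. r [list_encode w] = list_encode (h w)))"

definition initial_segment :: "baire \<Rightarrow> nat \<Rightarrow> nat list" where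
  "initial_segment p n = map p [0..<n]"

text \<open>A partial function \<open>F\<close> is computable if on its domain \<open>F p\<close> is the limit of the outputs of a
  recursive, prefix-monotone word function on the initial segments of \<open>p\<close> (the finite outputs that
  a Type-2 machine has produced after reading finitely much of its input).\<close>

definition computable_partial :: "(baire \<rightharpoonup> baire) \<Rightarrow> bool" where
  "computable_partial F \<longleftrightarrow>
     (\<exists>h. recursive_word_fun h \<and>
        (\<forall>u v. prefix u v \<longrightarrow> prefix (h u) (h v)) \<and>
        (\<forall>p q. F p = Some q \<longrightarrow>
           (\<forall>n. \<exists>m. h (initial_segment p n) = initial_segment q m) \<and>
           (\<forall>m. \<exists>n. m \<le> length (h (initial_segment p n)))))"

definition baire_pair :: "baire \<Rightarrow> baire \<Rightarrow> baire" where
  "baire_pair p q n = (if even n then p (n div 2) else q (n div 2))"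

definition computable_partial2 :: "(baire \<times> baire \<rightharpoonup> baire) \<Rightarrow> bool" where
  "computable_partial2 K \<longleftrightarrow>
     (\<exists>F. computable_partial F \<and> (\<forall>p q. K (p, q) = F (baire_pair p q)))"

definition reduces_via ::
  "'x representation \<Rightarrow> 'y representation \<Rightarrow> ('x, 'y) mvfun \<Rightarrow>
   'z representation \<Rightarrow> 'w representation \<Rightarrow> ('z, 'w) mvfun \<Rightarrow>
   (baire \<rightharpoonup> baire) \<Rightarrow> (baire \<times> baire \<rightharpoonup> baire) \<Rightarrow> bool" where
  "reduces_via dX dY g dZ dW h H K \<longleftrightarrow>
     (\<forall>G. realizes dZ dW G h \<longrightarrow>
        realizes dX dY (\<lambda>p. Option.bind (H p) (\<lambda>q. Option.bind (G q) (\<lambda>r. K (p, r)))) g)"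

definition weihrauch_le ::
  "'x representation \<Rightarrow> 'y representation \<Rightarrow> ('x, 'y) mvfun \<Rightarrow>
   'z representation \<Rightarrow> 'w representation \<Rightarrow> ('z, 'w) mvfun \<Rightarrow> bool" where
  "weihrauch_le dX dY g dZ dW h \<longleftrightarrow>
     (\<exists>H K. computable_partial H \<and> computable_partial2 K \<and> reduces_via dX dY g dZ dW h H K)"

definition continuous_weihrauch_le ::
  "'x representation \<Rightarrow> 'y representation \<Rightarrow> ('x, 'y) mvfun \<Rightarrow>
   'z representation \<Rightarrow> 'w representation \<Rightarrow> ('z, 'w) mvfun \<Rightarrow> bool" where
  "continuous_weihrauch_le dX dY g dZ dW h \<longleftrightarrow>
     (\<exists>H K. continuous_partial H \<and> continuous_partial K \<and> reduces_via dX dY g dZ dW h H K)"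

definition is_first_order_part :: "(baire, baire) mvfun \<Rightarrow> (baire, nat) mvfun \<Rightarrow> bool" where
  "is_first_order_part f g \<longleftrightarrow>
     weihrauch_le baire_rep nat_rep g baire_rep baire_rep f \<and>
     (\<forall>g'. weihrauch_le baire_rep nat_rep g' baire_rep baire_rep f \<longrightarrow>
           weihrauch_le baire_rep nat_rep g' baire_rep nat_rep g)"

text \<open>The maximum is determined only up to Weihrauch equivalence, so a representative is chosen.\<close>

definition first_order_part :: "(baire, baire) mvfun \<Rightarrow> (baire, nat) mvfun" where
  "first_order_part f = (SOME g. is_first_order_part f g)"

definition ACC_nat :: "(nat set, nat) mvfun" where
  "ACC_nat U = (if finite U \<and> card U \<le> 1 then - U else {})"

end

theory Submission
  imports Defs
begin

text \<open>The maximum defining the first-order part is attained by a problem whose instances contain an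
  instance of \<open>f\<close> together with an associate of the outer reduction, so discontinuity of the
  first-order part can be transferred along reductions in both directions.

  If the first-order part is discontinuous, it has a point \<open>x\<close> such that no number is a solution on a
  whole neighbourhood of \<open>x\<close>; a sequence of counterexamples converging to \<open>x\<close>, mapped by the inner
  reduction, is the required sequence. If \<open>f\<close> is discontinuous along \<open>a\<^sub>n \<longlonglongrightarrow> l\<close>, the discontinuity sits
  at \<open>l\<close>, as the other points are isolated. So every solution at \<open>l\<close> has a prefix that
  can be avoided arbitrarily close to \<open>l\<close>, and the codes of such prefixes solve \<open>ACC_nat\<close>. Finally,
  \<open>ACC_nat\<close> has no continuous realizer, and a continuous reduction of it to \<open>f\<close> passes through the
  first-order part, because the outer reduction has an associate.\<close>

section \<open>Recursive functions of several arguments\<close>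

text \<open>\<open>first_order_part\<close> is an arbitrary choice among the maxima, so nothing can
  be said about it until one maximum is exhibited. That is what the recursion theory below serves:
  the maximum has to be reduced to \<open>f\<close> computably, by an explicit search through coded
  words. Maximality speaks of computable reductions, whereas (3) supplies a merely continuous one.
  The gap closes because the tables stored in the instances of \<open>universal_problem\<close> are
  arbitrary sequences: a noncomputable outer reduction is just another table. Discreteness of the
  values is used twice. For a problem with numbers as solutions, discontinuity at a point means that
  each number separately is refuted arbitrarily near it, and one sequence refutes all of them by
  running through the pairs of a number and a distance. Conversely, solutions of \<open>f\<close>
  are infinite objects, and their finite prefixes, coded as numbers, become the answers to
  \<open>ACC_nat\<close>. That at most one number is excluded there lets the inner reduction leave
  the limit point once and never move again.\<close>

text \<open>Recursiveness up to the values on lists of the wrong length, which are junk; this makes it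
  possible to build recursive functions from arbitrary terms over the argument list.\<close>

definition recf :: "nat \<Rightarrow> (nat list \<Rightarrow> nat) \<Rightarrow> bool" where
  "recf n F \<longleftrightarrow> (\<exists>f. total_recursive n f \<and> (\<forall>xs. length xs = n \<longrightarrow> f xs = F xs))"

definition recp :: "nat \<Rightarrow> (nat list \<Rightarrow> bool) \<Rightarrow> bool" where
  "recp n P \<longleftrightarrow> recf n (\<lambda>xs. if P xs then 0 else 1)"

lemma recf_cong:
  assumes "recf n F" "\<And>xs. length xs = n \<Longrightarrow> F xs = G xs"
  shows "recf n G"
  using assms unfolding recf_def by metis

lemma recf_comp:
  assumes F: "recf (length Gs) F" and Gs: "\<And>G. G \<in> set Gs \<Longrightarrow> recf n G"
  shows "recf n (\<lambda>xs. F (map (\<lambda>G. G xs) Gs))"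
proof -
  obtain f where f: "total_recursive (length Gs) f" "\<forall>xs. length xs = length Gs \<longrightarrow> f xs = F xs"
    using F unfolding recf_def by blast
  have "\<forall>G\<in>set Gs. \<exists>g. total_recursive n g \<and> (\<forall>xs. length xs = n \<longrightarrow> g xs = G xs)"
    using Gs unfolding recf_def by blast
  then obtain h where h: "\<forall>G\<in>set Gs. total_recursive n (h G) \<and> (\<forall>xs. length xs = n \<longrightarrow> h G xs = G xs)"
    by metis
  have "total_recursive n (\<lambda>xs. f (map (\<lambda>g. g xs) (map h Gs)))"
    by (rule total_recursive.comp) (use f h in auto)
  moreover have "f (map (\<lambda>g. g xs) (map h Gs)) = F (map (\<lambda>G. G xs) Gs)" if "length xs = n" for xs
  proof -
    have "map (\<lambda>g. g xs) (map h Gs) = map (\<lambda>G. G xs) Gs"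
      using h that by simp
    then show ?thesis using f(2) by (metis length_map)
  qed
  ultimately show ?thesis unfolding recf_def by blast
qed

lemma recf_comp1: "recf 1 (\<lambda>xs. op (xs ! 0)) \<Longrightarrow> recf n A \<Longrightarrow> recf n (\<lambda>xs. op (A xs))"
  using recf_comp[of "[A]" "\<lambda>xs. op (xs ! 0)" n] by simp

lemma recf_comp2:
  "recf 2 (\<lambda>xs. op (xs ! 0) (xs ! 1)) \<Longrightarrow> recf n A \<Longrightarrow> recf n B \<Longrightarrow> recf n (\<lambda>xs. op (A xs) (B xs))"
  using recf_comp[of "[A, B]" "\<lambda>xs. op (xs ! 0) (xs ! 1)" n] by (auto simp: numeral_2_eq_2)

lemma recf_nth: "i < n \<Longrightarrow> recf n (\<lambda>xs. xs ! i)"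
  unfolding recf_def using total_recursive.proj by blast

lemma recf_hd: "0 < n \<Longrightarrow> recf n (\<lambda>xs. hd xs)"
  by (rule recf_cong[OF recf_nth[of 0]]) (auto simp: hd_conv_nth)

lemma recf_hd_tl: "Suc 0 < n \<Longrightarrow> recf n (\<lambda>xs. hd (tl xs))"
  by (rule recf_cong[OF recf_nth[of 1]]) (auto simp: hd_conv_nth nth_tl simp flip: length_greater_0_conv)

lemma recf_nth_tl: "Suc i < n \<Longrightarrow> recf n (\<lambda>xs. tl xs ! i)"
  by (rule recf_cong[OF recf_nth[of "Suc i"]]) (auto simp: nth_tl)

lemma recf_nth_tl_tl: "Suc (Suc i) < n \<Longrightarrow> recf n (\<lambda>xs. tl (tl xs) ! i)"
  by (rule recf_cong[OF recf_nth[of "Suc (Suc i)"]]) (auto simp: nth_tl)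

lemma recf_tl:
  assumes "recf n F"
  shows "recf (Suc n) (\<lambda>xs. F (tl xs))"
proof -
  have "recf (Suc n) (\<lambda>xs. F (map (\<lambda>G. G xs) (map (\<lambda>i xs. xs ! Suc i) [0..<n])))"
    by (rule recf_comp) (use assms in \<open>auto intro: recf_nth\<close>)
  then show ?thesis
    by (rule recf_cong) (auto simp: comp_def intro!: arg_cong[where f = F] nth_equalityI simp: nth_tl)
qed

lemma recf_0: "recf n (\<lambda>_. 0)"
  unfolding recf_def using total_recursive.zero by blast

lemma recf_Suc: "recf n F \<Longrightarrow> recf n (\<lambda>xs. Suc (F xs))"
proof (rule recf_comp1[where op = Suc])
  have "total_recursive 1 (\<lambda>xs. Suc (hd xs))" by (rule total_recursive.succ)
  then show "recf 1 (\<lambda>xs. Suc (xs ! 0))"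
    unfolding recf_def by (auto simp: length_Suc_conv)
qed

lemma recf_const: "recf n (\<lambda>_. c)"
  by (induction c) (auto intro: recf_0 recf_Suc)

text \<open>The scheme \<open>prec\<close> recurses on the first argument and passes the others on
  as parameters. To allow a computed bound \<open>K xs\<close>, its result is composed with
  \<open>K\<close> followed by all projections.\<close>

lemma recf_rec_nat:
  assumes A: "recf n A" and G: "recf (Suc (Suc n)) (\<lambda>ys. G (ys ! 0) (ys ! 1) (tl (tl ys)))"
    and K: "recf n K"
  shows "recf n (\<lambda>xs. rec_nat (A xs) (\<lambda>y r. G y r xs) (K xs))"
proof -
  obtain a where a: "total_recursive n a" "\<And>xs. length xs = n \<Longrightarrow> a xs = A xs"
    using A unfolding recf_def by blast
  obtain g where g: "total_recursive (Suc (Suc n)) g"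
    "\<And>xs. length xs = Suc (Suc n) \<Longrightarrow> g xs = G (xs ! 0) (xs ! 1) (tl (tl xs))"
    using G unfolding recf_def by blast
  have "total_recursive (Suc n) (\<lambda>xs. rec_nat (a (tl xs)) (\<lambda>y r. g (y # r # tl xs)) (hd xs))"
    by (rule total_recursive.prec[OF a(1) g(1)])
  moreover have "rec_nat (a (tl xs)) (\<lambda>y r. g (y # r # tl xs)) (hd xs)
      = rec_nat (A (tl xs)) (\<lambda>y r. G y r (tl xs)) (hd xs)" if "length xs = Suc n" for xs
    using that a(2) g(2) by simp
  ultimately have R: "recf (Suc n) (\<lambda>xs. rec_nat (A (tl xs)) (\<lambda>y r. G y r (tl xs)) (hd xs))"
    unfolding recf_def by blast
  let ?Gs = "K # map (\<lambda>i xs. xs ! i) [0..<n]"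
  have "recf n (\<lambda>xs. (\<lambda>xs. rec_nat (A (tl xs)) (\<lambda>y r. G y r (tl xs)) (hd xs)) (map (\<lambda>G. G xs) ?Gs))"
    by (rule recf_comp) (use R K in \<open>auto intro: recf_nth\<close>)
  moreover have "map ((\<lambda>G. G xs) \<circ> (\<lambda>i xs. xs ! i)) [0..<n] = xs" if "length xs = n" for xs :: "nat list"
    using that by (auto intro: nth_equalityI)
  ultimately show ?thesis
    by (auto intro: recf_cong)
qed

lemma recf_Least:
  assumes P: "recp (Suc n) (\<lambda>ys. P (hd ys) (tl ys))" and ex: "\<And>xs. length xs = n \<Longrightarrow> \<exists>y. P y xs"
  shows "recf n (\<lambda>xs. LEAST y. P y xs)"
proof -
  obtain f where f: "total_recursive (Suc n) f"
    "\<And>xs. length xs = Suc n \<Longrightarrow> f xs = (if P (hd xs) (tl xs) then 0 else 1)"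
    using P unfolding recf_def recp_def by blast
  have eq: "f (y # xs) = 0 \<longleftrightarrow> P y xs" if "length xs = n" for y xs
    using that f(2) by simp
  have "total_recursive n (\<lambda>xs. LEAST y. f (y # xs) = 0)"
    by (rule total_recursive.mu[OF f(1)]) (use ex eq in blast)
  then show ?thesis
    unfolding recf_def
    by (intro exI[where x = "\<lambda>xs. LEAST y. f (y # xs) = 0"] conjI) (simp_all add: eq)
qed

section \<open>Arithmetic, comparisons and bounded quantifiers\<close>

lemma recf_add: "recf n A \<Longrightarrow> recf n B \<Longrightarrow> recf n (\<lambda>xs. A xs + B xs)"
proof (rule recf_comp2[where op = "(+)"])
  have "recf 2 (\<lambda>xs. rec_nat (xs ! 0) (\<lambda>y r. Suc r) (xs ! 1))"
    by (intro recf_rec_nat recf_nth recf_Suc) auto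
  moreover have "rec_nat a (\<lambda>y r. Suc r) b = a + b" for a b by (induction b) auto
  ultimately show "recf 2 (\<lambda>xs. xs ! 0 + xs ! 1)" by simp
qed

lemma recf_mult: "recf n A \<Longrightarrow> recf n B \<Longrightarrow> recf n (\<lambda>xs. A xs * B xs)"
proof (rule recf_comp2[where op = "(*)"])
  have "recf 2 (\<lambda>xs. rec_nat 0 (\<lambda>y r. r + xs ! 0) (xs ! 1))"
    by (intro recf_rec_nat recf_nth recf_add recf_0 recf_nth_tl_tl) auto
  moreover have "rec_nat 0 (\<lambda>y r. r + a) b = a * b" for a b :: nat by (induction b) auto
  ultimately show "recf 2 (\<lambda>xs. xs ! 0 * xs ! 1)" by simp
qed

lemma recf_diff: "recf n A \<Longrightarrow> recf n B \<Longrightarrow> recf n (\<lambda>xs. A xs - B xs)"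
proof (rule recf_comp2[where op = "(-)"])
  have "recf 1 (\<lambda>xs. rec_nat 0 (\<lambda>y r. y) (xs ! 0))"
    by (intro recf_rec_nat recf_nth recf_0) auto
  moreover have "rec_nat 0 (\<lambda>y r. y) a = a - 1" for a by (induction a) auto
  ultimately have "recf 1 (\<lambda>xs. xs ! 0 - 1)" by simp
  \<comment> \<open>In a recursion with two parameters the step function has arity 4: entry 0 is the
    counter, entry 1 the accumulated value whose predecessor is taken, and the parameters
    follow.\<close>
  then have "recf 4 (\<lambda>xs. xs ! 1 - 1)" by (rule recf_comp1) (simp add: recf_nth)
  then have "recf 2 (\<lambda>xs. rec_nat (xs ! 0) (\<lambda>y r. r - 1) (xs ! 1))"
    by (intro recf_rec_nat recf_nth) (auto simp: eval_nat_numeral)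
  moreover have "rec_nat a (\<lambda>y r. r - 1) b = a - b" for a b :: nat by (induction b) auto
  ultimately show "recf 2 (\<lambda>xs. xs ! 0 - xs ! 1)" by simp
qed

lemma recp_less: "recf n A \<Longrightarrow> recf n B \<Longrightarrow> recp n (\<lambda>xs. A xs < B xs)"
  unfolding recp_def
  by (rule recf_cong[of n "\<lambda>xs. 1 - (B xs - A xs)"]) (auto intro: recf_const recf_diff)

lemma recp_not: "recp n P \<Longrightarrow> recp n (\<lambda>xs. \<not> P xs)"
  unfolding recp_def
  by (rule recf_cong[of n "\<lambda>xs. 1 - (if P xs then 0 else 1)"]) (auto intro: recf_const recf_diff)

lemma recp_conj: "recp n P \<Longrightarrow> recp n Q \<Longrightarrow> recp n (\<lambda>xs. P xs \<and> Q xs)"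
  unfolding recp_def
  by (rule recf_cong[of n "\<lambda>xs. 1 - (1 - (if P xs then 0 else 1)) * (1 - (if Q xs then 0 else 1))"])
    (auto intro!: recf_const recf_diff recf_mult)

lemma recp_disj: "recp n P \<Longrightarrow> recp n Q \<Longrightarrow> recp n (\<lambda>xs. P xs \<or> Q xs)"
  using recp_not[OF recp_conj[OF recp_not recp_not], of n P Q] by simp

lemma recp_le: "recf n A \<Longrightarrow> recf n B \<Longrightarrow> recp n (\<lambda>xs. A xs \<le> B xs)"
  using recp_not[OF recp_less, of n B A] by (simp add: not_less)

lemma recp_eq: "recf n A \<Longrightarrow> recf n B \<Longrightarrow> recp n (\<lambda>xs. A xs = B xs)"
  using recp_conj[OF recp_le recp_le, of n A B B A] by (simp add: eq_iff)

lemma recf_if: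
  assumes "recp n P" "recf n A" "recf n B"
  shows "recf n (\<lambda>xs. if P xs then A xs else B xs)"
proof -
  have "recf n (\<lambda>xs. (if P xs then 0 else 1) * B xs + (1 - (if P xs then 0 else 1)) * A xs)"
    using assms unfolding recp_def by (intro recf_add recf_mult recf_diff recf_const)
  then show ?thesis by (rule recf_cong) auto
qed

text \<open>Minimization applies only where a zero always exists, so the search for a counterexample
  is made to stop at \<open>K xs\<close> at the latest. The quantified statement holds exactly when
  it stops there.\<close>

lemma recp_all_less:
  assumes P: "recp (Suc n) (\<lambda>ys. P (hd ys) (tl ys))" and K: "recf n K"
  shows "recp n (\<lambda>xs. \<forall>i<K xs. P i xs)"
proof -
  let ?m = "\<lambda>xs. LEAST y. y = K xs \<or> (y < K xs \<and> \<not> P y xs)"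
  have "recf n ?m"
    by (rule recf_Least) (auto intro!: recp_disj recp_conj recp_not recp_eq recp_less recf_hd recf_tl P K)
  then have "recp n (\<lambda>xs. \<not> ?m xs < K xs)"
    by (intro recp_not recp_less K)
  moreover have "\<not> ?m xs < K xs \<longleftrightarrow> (\<forall>i<K xs. P i xs)" for xs
  proof -
    define m where "m = ?m xs"
    have "m = K xs \<or> (m < K xs \<and> \<not> P m xs)"
      unfolding m_def by (rule LeastI[of _ "K xs"]) blast
    moreover have "m \<le> i" if "i < K xs" "\<not> P i xs" for i
      unfolding m_def by (rule Least_le) (use that in blast)
    ultimately have "\<not> m < K xs \<longleftrightarrow> (\<forall>i<K xs. P i xs)"
      by (metis less_irrefl less_le_trans)
    then show ?thesis by (simp only: m_def)
  qed
  ultimately show ?thesis by simp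
qed

lemma recp_ex_less:
  assumes P: "recp (Suc n) (\<lambda>ys. P (hd ys) (tl ys))" and K: "recf n K"
  shows "recp n (\<lambda>xs. \<exists>i<K xs. P i xs)"
proof -
  have "recp n (\<lambda>xs. \<not> (\<forall>i<K xs. \<not> P i xs))"
    by (intro recp_not recp_all_less P K)
  then show ?thesis by simp
qed

section \<open>The pairing function and its inverse\<close>

lemma recf_prod_encode: "recf n A \<Longrightarrow> recf n B \<Longrightarrow> recf n (\<lambda>xs. prod_encode (A xs, B xs))"
proof (rule recf_comp2[where op = "\<lambda>a b. prod_encode (a, b)"])
  have "recf 1 (\<lambda>xs. rec_nat 0 (\<lambda>y r. r + Suc y) (xs ! 0))"
    by (intro recf_rec_nat recf_nth recf_add recf_0 recf_Suc) auto
  moreover have "rec_nat 0 (\<lambda>y r. r + Suc y) a = triangle a" for a by (induction a) auto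
  ultimately have "recf 1 (\<lambda>xs. triangle (xs ! 0))" by simp
  then have "recf 2 (\<lambda>xs. triangle (xs ! 0 + xs ! 1))"
    by (rule recf_comp1) (intro recf_add recf_nth; simp)
  then have "recf 2 (\<lambda>xs. triangle (xs ! 0 + xs ! 1) + xs ! 0)"
    by (intro recf_add recf_nth) auto
  then show "recf 2 (\<lambda>xs. prod_encode (xs ! 0, xs ! 1))"
    by (simp add: prod_encode_def)
qed

text \<open>The pairing is inverted by search. No component exceeds the code, so the quantifier over
  the second component can be bounded.\<close>

lemma recf_fst_prod_decode: "recf n A \<Longrightarrow> recf n (\<lambda>xs. fst (prod_decode (A xs)))"
proof (rule recf_comp1[where op = "\<lambda>a. fst (prod_decode a)"])
  have "recf 1 (\<lambda>xs. LEAST a. \<exists>b<Suc (xs ! 0). prod_encode (a, b) = xs ! 0)"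
  proof (rule recf_Least)
    show "recp (Suc 1) (\<lambda>ys. \<exists>b<Suc (tl ys ! 0). prod_encode (hd ys, b) = tl ys ! 0)"
      by (intro recp_ex_less recp_eq recf_prod_encode recf_tl recf_hd recf_nth_tl recf_Suc) auto
    show "\<exists>a. \<exists>b<Suc (xs ! 0). prod_encode (a, b) = xs ! 0" for xs :: "nat list"
      using le_prod_encode_2[of "snd (prod_decode (xs ! 0))" "fst (prod_decode (xs ! 0))"]
      by (intro exI[of _ "fst (prod_decode (xs ! 0))"] exI[of _ "snd (prod_decode (xs ! 0))"]) auto
  qed
  moreover have "(LEAST a. \<exists>b<Suc m. prod_encode (a, b) = m) = fst (prod_decode m)" for m
  proof (rule Least_equality)
    show "\<exists>b<Suc m. prod_encode (fst (prod_decode m), b) = m"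
      using le_prod_encode_2[of "snd (prod_decode m)" "fst (prod_decode m)"]
      by (intro exI[of _ "snd (prod_decode m)"]) auto
  qed auto
  ultimately show "recf 1 (\<lambda>xs. fst (prod_decode (xs ! 0)))" by simp
qed

lemma recf_snd_prod_decode: "recf n A \<Longrightarrow> recf n (\<lambda>xs. snd (prod_decode (A xs)))"
proof (rule recf_comp1[where op = "\<lambda>a. snd (prod_decode a)"])
  have "recf 1 (\<lambda>xs. LEAST b. prod_encode (fst (prod_decode (xs ! 0)), b) = xs ! 0)"
  proof (rule recf_Least)
    show "recp (Suc 1) (\<lambda>ys. prod_encode (fst (prod_decode (tl ys ! 0)), hd ys) = tl ys ! 0)"
      by (intro recp_eq recf_prod_encode recf_fst_prod_decode recf_hd recf_nth_tl) auto
    show "\<exists>b. prod_encode (fst (prod_decode (xs ! 0)), b) = xs ! 0" for xs :: "nat list"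
      by (intro exI[of _ "snd (prod_decode (xs ! 0))"]) auto
  qed
  moreover have "(LEAST b. prod_encode (fst (prod_decode m), b) = m) = snd (prod_decode m)" for m
    by (rule Least_equality) (auto, metis order_refl prod_encode_inverse snd_conv)
  ultimately show "recf 1 (\<lambda>xs. snd (prod_decode (xs ! 0)))" by simp
qed

lemma recf_div: "recf n A \<Longrightarrow> 0 < c \<Longrightarrow> recf n (\<lambda>xs. A xs div c)"
proof (rule recf_comp1[where op = "\<lambda>a. a div c"])
  assume c: "0 < c"
  have "recf 1 (\<lambda>xs. LEAST q. xs ! 0 < Suc q * c)"
  proof (rule recf_Least)
    show "recp (Suc 1) (\<lambda>ys. tl ys ! 0 < Suc (hd ys) * c)"
      by (intro recp_less recf_nth_tl recf_mult recf_Suc recf_hd recf_const) auto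
    show "\<exists>q. xs ! 0 < Suc q * c" for xs :: "nat list"
      using c by (metis dividend_less_div_times mult_Suc mult.commute)
  qed
  moreover have "(LEAST q. m < Suc q * c) = m div c" for m
    by (rule Least_equality)
      (use c in \<open>auto simp: dividend_less_div_times less_mult_imp_div_less less_Suc_eq_le[symmetric]\<close>)
  ultimately show "recf 1 (\<lambda>xs. xs ! 0 div c)" by simp
qed

lemma recp_even: "recf n A \<Longrightarrow> recp n (\<lambda>xs. even (A xs))"
proof -
  assume A: "recf n A"
  have "recp n (\<lambda>xs. A xs = A xs div 2 * 2)"
    by (intro recp_eq recf_mult recf_div recf_const A) auto
  moreover have "m = m div 2 * 2 \<longleftrightarrow> even m" for m :: nat by presburger
  ultimately show ?thesis by simp
qed

section \<open>Access to coded lists\<close>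

definition entry :: "nat list \<Rightarrow> nat \<Rightarrow> nat" where
  "entry w i = (if i < length w then w ! i else 0)"

lemma list_decode_pos: "0 < m \<Longrightarrow>
    list_decode m = fst (prod_decode (m - 1)) # list_decode (snd (prod_decode (m - 1)))"
  by (cases m) (auto split: prod.split)

lemma prod_decode_0: "prod_decode 0 = (0, 0)"
  by (metis le_prod_encode_1 le_prod_encode_2 le_zero_eq prod.collapse prod_decode_inverse)

text \<open>The code of a nonempty list is the successor of the code of the pair of its head and the
  code of its tail, so each step passes to the tail. At code 0 truncated subtraction and
  \<open>prod_decode_0\<close> keep the list empty, as \<open>drop\<close> does.\<close>

definition code_drop :: "nat \<Rightarrow> nat \<Rightarrow> nat" where
  "code_drop i m = rec_nat m (\<lambda>_ r. snd (prod_decode (r - 1))) i"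

lemma list_decode_code_drop: "list_decode (code_drop i m) = drop i (list_decode m)"
proof (induction i)
  case (Suc i)
  have "list_decode (snd (prod_decode (r - 1))) = tl (list_decode r)" for r
    by (cases "r = 0") (auto simp: prod_decode_0 list_decode_pos)
  then show ?case
    using Suc by (simp add: code_drop_def drop_Suc tl_drop)
qed (simp add: code_drop_def)

lemma list_decode_eq_Nil: "list_decode m = [] \<longleftrightarrow> m = 0"
  by (cases m) (auto split: prod.split)

lemma recf_code_drop: "recf n A \<Longrightarrow> recf n B \<Longrightarrow> recf n (\<lambda>xs. code_drop (A xs) (B xs))"
proof (rule recf_comp2[where op = code_drop])
  show "recf 2 (\<lambda>xs. code_drop (xs ! 0) (xs ! 1))"
    unfolding code_drop_def
    by (intro recf_rec_nat recf_nth recf_snd_prod_decode recf_diff recf_const) auto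
qed

lemma recf_entry:
  "recf n A \<Longrightarrow> recf n B \<Longrightarrow> recf n (\<lambda>xs. entry (list_decode (A xs)) (B xs))"
proof (rule recf_comp2[where op = "\<lambda>a b. entry (list_decode a) b"])
  have "fst (prod_decode (code_drop i m - 1)) = entry (list_decode m) i" for i m
  proof (cases "code_drop i m = 0")
    case True
    then show ?thesis
      using list_decode_code_drop[of i m] by (auto simp: entry_def prod_decode_0)
  next
    case False
    then show ?thesis
      using list_decode_code_drop[of i m]
      by (cases "i < length (list_decode m)")
        (auto simp: entry_def list_decode_pos Cons_nth_drop_Suc[symmetric])
  qed
  then show "recf 2 (\<lambda>xs. entry (list_decode (xs ! 0)) (xs ! 1))"
    by (auto intro!: recf_cong[OF recf_fst_prod_decode[OF recf_diff[OF recf_code_drop[OF recf_nth recf_nth]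
         recf_const[of 2 1]], of 1 0]])
qed

lemma recf_length: "recf n A \<Longrightarrow> recf n (\<lambda>xs. length (list_decode (A xs)))"
proof (rule recf_comp1[where op = "\<lambda>a. length (list_decode a)"])
  have eq: "code_drop i m = 0 \<longleftrightarrow> length (list_decode m) \<le> i" for i m
    using list_decode_code_drop[of i m] by (simp flip: list_decode_eq_Nil)
  have "recf 1 (\<lambda>xs. LEAST i. code_drop i (xs ! 0) = 0)"
    by (intro recf_Least recp_eq recf_code_drop recf_hd recf_nth_tl recf_0) (auto simp: eq)
  moreover have "(LEAST i. code_drop i m = 0) = length (list_decode m)" for m
    by (rule Least_equality) (auto simp: eq)
  ultimately show "recf 1 (\<lambda>xs. length (list_decode (xs ! 0)))" by simp
qed

text \<open>Codes grow at the front of a list, so the recursion runs backwards: after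
  \<open>j\<close> steps it holds the code of the last \<open>j\<close> entries. Hence the index
  \<open>k - Suc i\<close>.\<close>

lemma recf_list_encode_map:
  assumes G: "recf (Suc n) (\<lambda>ys. G (hd ys) (tl ys))" and L: "recf n L"
  shows "recf n (\<lambda>xs. list_encode (map (\<lambda>i. G i xs) [0..<L xs]))"
proof -
  have "list_encode (map F [k - j..<k]) =
      rec_nat 0 (\<lambda>i r. Suc (prod_encode (F (k - Suc i), r))) j" if "j \<le> k" for j k F
    using that
  proof (induction j)
    case (Suc j)
    then have "[k - Suc j..<k] = (k - Suc j) # [k - j..<k]"
      by (metis Suc_diff_Suc Suc_le_lessD diff_less upt_conv_Cons zero_less_Suc less_le_trans)
    with Suc show ?case by simp
  qed simp
  from this[OF le_refl] have eq: "list_encode (map F [0..<k]) =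
      rec_nat 0 (\<lambda>i r. Suc (prod_encode (F (k - Suc i), r))) k" for k F
    by simp
  have "recf (Suc (Suc n)) (\<lambda>ys. G (L (tl (tl ys)) - Suc (ys ! 0)) (tl (tl ys)))"
  proof -
    let ?Gs = "(\<lambda>ys. L (tl (tl ys)) - Suc (ys ! 0)) # map (\<lambda>i ys. ys ! Suc (Suc i)) [0..<n]"
    have "recf (Suc (Suc n)) (\<lambda>ys. (\<lambda>ys. G (hd ys) (tl ys)) (map (\<lambda>G. G ys) ?Gs))"
      by (rule recf_comp) (use G in \<open>auto intro!: recf_nth recf_diff recf_Suc recf_tl L
        recf_tl[of _ "\<lambda>ys. L (tl ys)"]\<close>)
    moreover have "map ((\<lambda>G. G ys) \<circ> (\<lambda>i ys. ys ! Suc (Suc i))) [0..<n] = tl (tl ys)"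
      if "length ys = Suc (Suc n)" for ys :: "nat list"
      using that by (auto intro!: nth_equalityI simp: nth_tl)
    ultimately show ?thesis
      by (auto elim!: recf_cong)
  qed
  then show ?thesis
    unfolding eq
    by (intro recf_rec_nat recf_Suc recf_prod_encode recf_nth recf_0 L) auto
qed

section \<open>Computable maps on Baire space\<close>

lemmas recf_intros = recf_nth recf_hd recf_hd_tl recf_nth_tl recf_nth_tl_tl recf_Suc recf_const
  recf_add recf_mult recf_diff recf_if recf_div recf_prod_encode recf_fst_prod_decode
  recf_snd_prod_decode recf_entry recf_length
  recp_less recp_le recp_eq recp_not recp_conj recp_disj recp_even

lemma recursive_word_funI:
  assumes "recf 1 (\<lambda>xs. list_encode (h (list_decode (xs ! 0))))"
  shows "recursive_word_fun h"
proof -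
  obtain r where r: "total_recursive 1 r"
    "\<forall>xs. length xs = 1 \<longrightarrow> r xs = list_encode (h (list_decode (xs ! 0)))"
    using assms unfolding recf_def by blast
  then have "r [list_encode w] = list_encode (h w)" for w
    by (auto simp: list_encode_inverse)
  with r(1) show ?thesis unfolding recursive_word_fun_def by blast
qed

lemma recursive_word_funD:
  assumes "recursive_word_fun h"
  shows "recf 1 (\<lambda>xs. list_encode (h (list_decode (xs ! 0))))"
proof -
  obtain r where r: "total_recursive 1 r" "\<forall>w. r [list_encode w] = list_encode (h w)"
    using assms unfolding recursive_word_fun_def by blast
  have "r xs = list_encode (h (list_decode (xs ! 0)))" if "length xs = 1" for xs
    using that r(2)[rule_format, of "list_decode (xs ! 0)"]
    by (auto simp: list_decode_inverse length_Suc_conv)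
  with r(1) show ?thesis unfolding recf_def by blast
qed

lemma length_initial_segment [simp]: "length (initial_segment p n) = n"
  by (simp add: initial_segment_def)

lemma initial_segment_eq_iff: "initial_segment p n = initial_segment q n \<longleftrightarrow> (\<forall>i<n. p i = q i)"
  by (auto simp: initial_segment_def)

lemma initial_segment_antimono:
  "initial_segment p n = initial_segment q n \<Longrightarrow> m \<le> n \<Longrightarrow> initial_segment p m = initial_segment q m"
  by (auto simp: initial_segment_eq_iff)

lemma entry_initial_segment: "i < n \<Longrightarrow> entry (initial_segment p n) i = p i"
  by (simp add: entry_def initial_segment_def)

lemma entry_prefix: "prefix u v \<Longrightarrow> i < length u \<Longrightarrow> entry v i = entry u i"
  by (auto simp: entry_def prefix_def nth_append)

lemma initial_segment_eqI: "length w = n \<Longrightarrow> (\<And>i. i < n \<Longrightarrow> entry w i = p i) \<Longrightarrow> w = initial_segment p n"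
  by (auto intro!: nth_equalityI simp: initial_segment_def entry_def)

text \<open>A machine is described by the number \<open>L u\<close> of output entries fixed after
  reading \<open>u\<close> and by these entries \<open>E i u\<close>. Only numerical functions then
  have to be shown recursive, and prefix monotonicity splits into growth of \<open>L\<close> and
  stability of \<open>E\<close>.\<close>

lemma computable_partialI:
  assumes L: "recf 1 (\<lambda>xs. L (list_decode (xs ! 0)))"
    and E: "recf 2 (\<lambda>xs. E (xs ! 0) (list_decode (xs ! 1)))"
    and mono: "\<And>u v. prefix u v \<Longrightarrow> L u \<le> L v"
    and stable: "\<And>u v i. prefix u v \<Longrightarrow> i < L u \<Longrightarrow> E i v = E i u"
    and correct: "\<And>p q n i. F p = Some q \<Longrightarrow> i < L (initial_segment p n) \<Longrightarrow>
      E i (initial_segment p n) = q i"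
    and unbounded: "\<And>p q m. F p = Some q \<Longrightarrow> \<exists>n. m \<le> L (initial_segment p n)"
  shows "computable_partial F"
proof -
  define h where "h = (\<lambda>u. map (\<lambda>i. E i u) [0..<L u])"
  have [simp]: "length (h u) = L u" for u by (simp add: h_def)
  have "recf (Suc 1) (\<lambda>xs. E (hd xs) (list_decode (tl xs ! 0)))"
    by (rule recf_cong[where F = "\<lambda>xs. E (xs ! 0) (list_decode (xs ! 1))"])
      (use E in \<open>auto simp: numeral_2_eq_2 hd_conv_nth nth_tl simp flip: length_greater_0_conv\<close>)
  then have "recursive_word_fun h"
    unfolding h_def
    by (intro recursive_word_funI recf_list_encode_map[where L = "\<lambda>xs. L (list_decode (xs ! 0))"] L)
      simp
  moreover have "prefix (h u) (h v)" if "prefix u v" for u v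
  proof -
    have "h u = take (L u) (h v)"
      using mono[OF that] stable[OF that] by (auto intro!: nth_equalityI simp: h_def)
    then show ?thesis by (metis take_is_prefix)
  qed
  moreover have "h (initial_segment p n) = initial_segment q (L (initial_segment p n))"
    if "F p = Some q" for p q n
    using correct[OF that] by (auto intro!: nth_equalityI simp: h_def initial_segment_def)
  ultimately show ?thesis
    unfolding computable_partial_def using unbounded by (intro exI[of _ h]) fastforce
qed

definition baire_fst :: "baire \<Rightarrow> baire" where "baire_fst t n = t (2 * n)"
definition baire_snd :: "baire \<Rightarrow> baire" where "baire_snd t n = t (2 * n + 1)"

lemma baire_fst_pair [simp]: "baire_fst (baire_pair p q) = p"
  by (auto simp: baire_fst_def baire_pair_def)

lemma baire_snd_pair [simp]: "baire_snd (baire_pair p q) = q"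
  by (auto simp: baire_snd_def baire_pair_def)

lemma computable_baire_fst: "computable_partial (\<lambda>t. Some (baire_fst t))"
proof (rule computable_partialI[where L = "\<lambda>u. length u div 2" and E = "\<lambda>i u. entry u (2 * i)"])
  show "recf 1 (\<lambda>xs. length (list_decode (xs ! 0)) div 2)"
    "recf 2 (\<lambda>xs. entry (list_decode (xs ! 1)) (2 * (xs ! 0)))"
    by (intro recf_intros; simp)+
  show "\<exists>n. m \<le> length (initial_segment p n) div 2" for p m
    by (intro exI[of _ "2 * m"]) simp
qed (auto simp: baire_fst_def entry_initial_segment entry_prefix prefix_length_le div_le_mono)

lemma computable_baire_snd: "computable_partial (\<lambda>t. Some (baire_snd t))"
proof (rule computable_partialI[where L = "\<lambda>u. length u div 2" and E = "\<lambda>i u. entry u (2 * i + 1)"])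
  show "recf 1 (\<lambda>xs. length (list_decode (xs ! 0)) div 2)"
    "recf 2 (\<lambda>xs. entry (list_decode (xs ! 1)) (2 * (xs ! 0) + 1))"
    by (intro recf_intros; simp)+
  show "\<exists>n. m \<le> length (initial_segment p n) div 2" for p m
    by (intro exI[of _ "2 * m"]) simp
  show "entry v (2 * i + 1) = entry u (2 * i + 1)" if "prefix u v" "i < length u div 2" for u v i
    using that by (intro entry_prefix) auto
  show "entry (initial_segment p n) (2 * i + 1) = q i"
    if "Some (baire_snd p) = Some q" "i < length (initial_segment p n) div 2" for p q n i
    using that by (auto simp: baire_snd_def entry_initial_segment)
qed (auto simp: prefix_length_le div_le_mono)

text \<open>A realizer of a problem on Baire space may answer each instance independently: altered
  at the single point \<open>q\<close> to any correct answer, it is still a realizer. Quantifying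
  over realizers thus amounts to quantifying over single answers. Surjectivity of \<open>dW\<close>
  provides a realizer to start from.\<close>

lemma reduces_via_iff:
  assumes "\<And>y. \<exists>r. dW r = Some y"
  shows "reduces_via dX dY g baire_rep dW h H K \<longleftrightarrow>
    (\<forall>p x. dX p = Some x \<and> x \<in> mv_dom g \<longrightarrow>
      (\<exists>q. H p = Some q \<and> q \<in> mv_dom h \<and>
        (\<forall>r y. dW r = Some y \<and> y \<in> h q \<longrightarrow> (\<exists>s v. K (p, r) = Some s \<and> dY s = Some v \<and> v \<in> g x))))"
    (is "_ = ?R")
proof
  assume red: "reduces_via dX dY g baire_rep dW h H K"
  have "\<forall>q\<in>mv_dom h. \<exists>r y. dW r = Some y \<and> y \<in> h q"
    using assms unfolding mv_dom_def by blast
  then obtain c where c: "\<And>q. q \<in> mv_dom h \<Longrightarrow> \<exists>y. dW (c q) = Some y \<and> y \<in> h q"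
    by metis
  show ?R
  proof (intro allI impI, elim conjE)
    fix p x assume px: "dX p = Some x" "x \<in> mv_dom g"
    \<comment> \<open>Undefined off \<open>mv_dom h\<close>, so that definedness of the composite at
      \<open>p\<close> forces the value of \<open>H p\<close> into \<open>mv_dom h\<close>.\<close>
    define G where "G q = (if q \<in> mv_dom h then Some (c q) else None)" for q
    have "realizes baire_rep dW G h"
      using c by (auto simp: realizes_def baire_rep_def G_def)
    with red have "realizes dX dY (\<lambda>p. Option.bind (H p) (\<lambda>q. Option.bind (G q) (\<lambda>r. K (p, r)))) g"
      unfolding reduces_via_def by blast
    with px obtain s where "Option.bind (H p) (\<lambda>q. Option.bind (G q) (\<lambda>r. K (p, r))) = Some s"
      unfolding realizes_def by blast
    then obtain q where q: "H p = Some q" "G q \<noteq> None"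
      by (auto simp: bind_eq_Some_conv)
    have "\<exists>s v. K (p, r) = Some s \<and> dY s = Some v \<and> v \<in> g x" if r: "dW r = Some y" "y \<in> h q" for r y
    proof -
      have "realizes baire_rep dW (G(q \<mapsto> r)) h"
        using c r by (auto simp: realizes_def baire_rep_def G_def)
      with red px have "\<exists>s v. Option.bind (H p) (\<lambda>q'. Option.bind ((G(q \<mapsto> r)) q') (\<lambda>r. K (p, r))) = Some s
          \<and> dY s = Some v \<and> v \<in> g x"
        unfolding reduces_via_def realizes_def by blast
      with q(1) show ?thesis by simp
    qed
    with q show "\<exists>q. H p = Some q \<and> q \<in> mv_dom h \<and> (\<forall>r y. dW r = Some y \<and> y \<in> h q \<longrightarrow>
        (\<exists>s v. K (p, r) = Some s \<and> dY s = Some v \<and> v \<in> g x))"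
      by (intro exI[of _ q]) (auto simp: G_def split: if_splits)
  qed
next
  assume R: ?R
  show "reduces_via dX dY g baire_rep dW h H K"
    unfolding reduces_via_def
  proof (intro allI impI)
    fix G assume G: "realizes baire_rep dW G h"
    show "realizes dX dY (\<lambda>p. Option.bind (H p) (\<lambda>q. Option.bind (G q) (\<lambda>r. K (p, r)))) g"
      unfolding realizes_def
    proof (intro allI impI)
      fix p x assume "dX p = Some x \<and> x \<in> mv_dom g"
      with R obtain q where q: "H p = Some q" "q \<in> mv_dom h"
        "\<And>r y. dW r = Some y \<Longrightarrow> y \<in> h q \<Longrightarrow> \<exists>s v. K (p, r) = Some s \<and> dY s = Some v \<and> v \<in> g x"
        by metis
      moreover obtain r y where "G q = Some r" "dW r = Some y" "y \<in> h q"
        using G q(2) unfolding realizes_def baire_rep_def by blast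
      ultimately show "\<exists>s v. Option.bind (H p) (\<lambda>q. Option.bind (G q) (\<lambda>r. K (p, r))) = Some s \<and>
          dY s = Some v \<and> v \<in> g x"
        by simp
    qed
  qed
qed

lemma baire_rep_surj: "\<exists>r. baire_rep r = Some y"
  by (simp add: baire_rep_def)

lemma nat_rep_surj: "\<exists>r. nat_rep r = Some y"
  by (auto simp: nat_rep_def)

lemmas reduces_via_baire_iff = reduces_via_iff[OF baire_rep_surj]
  and reduces_via_nat_iff = reduces_via_iff[OF nat_rep_surj]

section \<open>Existence of the first-order part\<close>

text \<open>An associate \<open>b\<close> assigns to (the code of) a word \<open>w\<close> either \<open>0\<close>, meaning that \<open>w\<close> does not yet
  determine a value, or the code of a list whose head is the value. The latter format lets the table
  of a recursive word function serve as an associate unchanged.\<close>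

definition assoc_yields :: "baire \<Rightarrow> baire \<Rightarrow> nat \<Rightarrow> bool" where
  "assoc_yields b z v \<longleftrightarrow> (\<exists>n. b (list_encode (initial_segment z n)) \<noteq> 0 \<and>
     v = fst (prod_decode (b (list_encode (initial_segment z n)) - 1)))"

text \<open>An instance consists of an instance \<open>q\<close> of \<open>f\<close>, the parameter \<open>p\<close>, and an associate \<open>b\<close> of the
  outer reduction. As the reductions themselves are part of the instance, no universal machine is
  needed to reduce every \<open>g \<le>\<^sub>W f\<close> to this problem.\<close>

definition universal_problem :: "(baire, baire) mvfun \<Rightarrow> (baire, nat) mvfun" where
  "universal_problem f t =
     (let q = baire_fst t; b = baire_fst (baire_snd t); p = baire_snd (baire_snd t)
      in if q \<in> mv_dom f \<and> (\<forall>y\<in>f q. \<exists>v. assoc_yields b (baire_pair p y) v)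
         then {v. \<exists>y\<in>f q. assoc_yields b (baire_pair p y) v} else {})"

lemma mv_dom_universal_problem:
  "baire_pair q (baire_pair b p) \<in> mv_dom (universal_problem f) \<longleftrightarrow>
     q \<in> mv_dom f \<and> (\<forall>y\<in>f q. \<exists>v. assoc_yields b (baire_pair p y) v)"
  by (auto simp: mv_dom_def universal_problem_def)

lemma universal_problemD:
  "v \<in> universal_problem f (baire_pair q (baire_pair b p)) \<Longrightarrow> \<exists>y\<in>f q. assoc_yields b (baire_pair p y) v"
  by (auto simp: universal_problem_def split: if_splits)

text \<open>In \<open>baire_pair t y\<close> with \<open>t = baire_pair q (baire_pair b p)\<close>, the value \<open>b n\<close> is at position
  \<open>8 * n + 2\<close>, and \<open>baire_pair p y i\<close> is at position \<open>4 * i + 6\<close> for even \<open>i\<close> and at position \<open>i\<close> for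
  odd \<open>i\<close>. The first \<open>10 * n + 10\<close> entries suffice to examine the word with code \<open>n\<close>, because its
  length is at most \<open>n\<close>.\<close>

definition code_hit :: "nat \<Rightarrow> nat list \<Rightarrow> bool" where
  "code_hit n u \<longleftrightarrow> 10 * n + 10 \<le> length u \<and> entry u (8 * n + 2) \<noteq> 0 \<and>
     (\<forall>i<length (list_decode n). entry (list_decode n) i = entry u (if even i then 4 * i + 6 else i))"

text \<open>The disjunct \<open>length u \<le> n\<close> makes the search total. A result below
  \<open>length u\<close> is a genuine hit, and every hit is below \<open>length u\<close> because
  of the number of letters that \<open>code_hit\<close> demands.\<close>

definition code_search :: "nat list \<Rightarrow> nat" where
  "code_search u = (LEAST n. length u \<le> n \<or> code_hit n u)"

definition baire_hit :: "nat \<Rightarrow> baire \<Rightarrow> bool" where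
  "baire_hit n s \<longleftrightarrow> s (8 * n + 2) \<noteq> 0 \<and>
     (\<forall>i<length (list_decode n). entry (list_decode n) i = s (if even i then 4 * i + 6 else i))"

lemma length_list_decode_le: "length (list_decode n) \<le> n"
proof -
  have "length w \<le> list_encode w" for w
  proof (induction w)
    case (Cons a w)
    then show ?case using le_prod_encode_2[of "list_encode w" a] by simp
  qed simp
  from this[of "list_decode n"] show ?thesis by (simp add: list_decode_inverse)
qed

lemma code_hit_prefix:
  assumes "prefix u v"
  shows "code_hit n u \<longleftrightarrow> code_hit n v \<and> 10 * n + 10 \<le> length u"
proof (cases "10 * n + 10 \<le> length u")
  case True
  have "entry v (8 * n + 2) = entry u (8 * n + 2)"
    by (rule entry_prefix[OF assms]) (use True in linarith)
  moreover have "entry v (if even i then 4 * i + 6 else i) = entry u (if even i then 4 * i + 6 else i)"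
    if "i < length (list_decode n)" for i
    by (rule entry_prefix[OF assms]) (use True that length_list_decode_le[of n] in auto)
  ultimately show ?thesis
    using True prefix_length_le[OF assms] by (auto simp: code_hit_def)
qed (auto simp: code_hit_def)

lemma code_hit_initial_segment:
  "code_hit n (initial_segment s m) \<longleftrightarrow> baire_hit n s \<and> 10 * n + 10 \<le> m"
proof (cases "10 * n + 10 \<le> m")
  case True
  have "entry (initial_segment s m) (8 * n + 2) = s (8 * n + 2)"
    by (rule entry_initial_segment) (use True in linarith)
  moreover have "entry (initial_segment s m) (if even i then 4 * i + 6 else i) = s (if even i then 4 * i + 6 else i)"
    if "i < length (list_decode n)" for i
    by (rule entry_initial_segment) (use True that length_list_decode_le[of n] in auto)
  ultimately show ?thesis
    using True by (auto simp: code_hit_def baire_hit_def)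
qed (auto simp: code_hit_def)

lemma code_search_less_iff: "code_search u < length u \<longleftrightarrow> (\<exists>n. code_hit n u)"
  and code_search_hit: "code_hit n u \<Longrightarrow> code_hit (code_search u) u \<and> code_search u \<le> n"
proof -
  have *: "length u \<le> code_search u \<or> code_hit (code_search u) u"
    unfolding code_search_def by (rule LeastI[of _ "length u"]) simp
  have le: "code_search u \<le> n" if "code_hit n u" for n
    unfolding code_search_def by (rule Least_le) (use that in blast)
  have lt: "n < length u" if "code_hit n u" for n
    using that by (auto simp: code_hit_def)
  show "code_search u < length u \<longleftrightarrow> (\<exists>n. code_hit n u)"
    using * le lt by (meson le_less_trans not_le)
  show "code_hit (code_search u) u \<and> code_search u \<le> n" if "code_hit n u"
    using * le[OF that] lt[OF that] by auto
qed

text \<open>Further input might be feared to reveal a hit with a smaller code. But the demanded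
  number of letters increases with the code, so every code below a hit in \<open>u\<close> was
  already decided by \<open>u\<close>. This is why \<open>code_hit\<close> demands
  \<open>10 * n + 10\<close> letters and not just those it inspects.\<close>

lemma code_search_prefix:
  assumes "prefix u v" "code_hit n u"
  shows "code_search v = code_search u"
proof (rule antisym)
  have u: "code_hit (code_search u) u" using code_search_hit[OF assms(2)] by blast
  then have v: "code_hit (code_search u) v" using code_hit_prefix[OF assms(1)] by blast
  from code_search_hit[OF v] show le: "code_search v \<le> code_search u" by blast
  have "code_hit (code_search v) v" using code_search_hit[OF v] by blast
  moreover have "10 * code_search v + 10 \<le> length u"
    using le u by (auto simp: code_hit_def)
  ultimately have "code_hit (code_search v) u"
    using code_hit_prefix[OF assms(1)] by blast
  then show "code_search u \<le> code_search v" using code_search_hit by blast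
qed

lemma recf_code_search: "recf n A \<Longrightarrow> recf n (\<lambda>xs. code_search (list_decode (A xs)))"
proof (rule recf_comp1[where op = "\<lambda>a. code_search (list_decode a)"])
  show "recf 1 (\<lambda>xs. code_search (list_decode (xs ! 0)))"
    unfolding code_search_def code_hit_def
    by (intro recf_Least recf_intros recp_all_less; force)
qed

text \<open>An arbitrary table may give several values along one point.
  \<open>universal_problem\<close> accepts all of them, so the value at the least hit will do; it is
  repeated forever because a name of a number is a whole sequence.\<close>

definition baire_evaluate :: "baire \<rightharpoonup> baire" where
  "baire_evaluate s = (if \<exists>n. baire_hit n s
     then Some (\<lambda>_. fst (prod_decode (s (8 * (LEAST n. baire_hit n s) + 2) - 1))) else None)"

text \<open>Nothing is written before a hit is found; afterwards there are as many copies of the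
  value as letters read, which makes the output infinite.\<close>

lemma computable_baire_evaluate: "computable_partial baire_evaluate"
proof (rule computable_partialI[where L = "\<lambda>u. if code_search u < length u then length u else 0" and
      E = "\<lambda>i u. fst (prod_decode (entry u (8 * code_search u + 2) - 1))"])
  show "recf 1 (\<lambda>xs. if code_search (list_decode (xs ! 0)) < length (list_decode (xs ! 0))
      then length (list_decode (xs ! 0)) else 0)"
    by (intro recf_intros recf_code_search; simp)
  show "recf 2 (\<lambda>xs. fst (prod_decode (entry (list_decode (xs ! 1))
      (8 * code_search (list_decode (xs ! 1)) + 2) - 1)))"
    by (intro recf_intros recf_code_search; simp)
next
  fix u v :: "nat list" assume "prefix u v"
  then show "(if code_search u < length u then length u else 0)
      \<le> (if code_search v < length v then length v else 0)"
    using code_search_less_iff code_hit_prefix prefix_length_le by auto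
next
  fix u v i assume uv: "prefix u v" and "i < (if code_search u < length u then length u else 0)"
  then obtain n where n: "code_hit n u"
    by (auto simp: code_search_less_iff split: if_splits)
  have "entry v (8 * code_search u + 2) = entry u (8 * code_search u + 2)"
    by (rule entry_prefix[OF uv]) (use code_search_hit[OF n] in \<open>auto simp: code_hit_def\<close>)
  then show "fst (prod_decode (entry v (8 * code_search v + 2) - 1))
      = fst (prod_decode (entry u (8 * code_search u + 2) - 1))"
    using code_search_prefix[OF uv n] by simp
next
  fix p q m i assume q: "baire_evaluate p = Some q"
    and "i < (if code_search (initial_segment p m) < length (initial_segment p m)
      then length (initial_segment p m) else 0)"
  then obtain n where n: "code_hit n (initial_segment p m)"
    by (metis code_search_less_iff not_less_zero)
  let ?k = "code_search (initial_segment p m)"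
  have k: "baire_hit ?k p" "10 * ?k + 10 \<le> m"
    using code_search_hit[OF n] by (auto simp: code_hit_initial_segment)
  have "(LEAST n. baire_hit n p) = ?k"
  proof (rule Least_equality)
    fix j assume "baire_hit j p"
    then show "?k \<le> j"
      using k(2) code_search_hit[of j "initial_segment p m"]
      by (cases "j \<le> ?k") (auto simp: code_hit_initial_segment)
  qed (rule k)
  moreover have "entry (initial_segment p m) (8 * ?k + 2) = p (8 * ?k + 2)"
    by (rule entry_initial_segment) (use k in linarith)
  ultimately show "fst (prod_decode (entry (initial_segment p m) (8 * ?k + 2) - 1)) = q i"
    using q by (auto simp: baire_evaluate_def split: if_splits)
next
  fix p q m assume "baire_evaluate p = Some q"
  then obtain n where n: "baire_hit n p"
    by (auto simp: baire_evaluate_def split: if_splits)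
  let ?N = "m + 10 * n + 10"
  have "code_hit n (initial_segment p ?N)"
    using n by (simp add: code_hit_initial_segment)
  then have "code_search (initial_segment p ?N) < length (initial_segment p ?N)"
    using code_search_less_iff by blast
  then show "\<exists>N. m \<le> (if code_search (initial_segment p N) < length (initial_segment p N)
      then length (initial_segment p N) else 0)"
    by (intro exI[of _ ?N]) auto
qed

lemma baire_hit_pair:
  "baire_hit n (baire_pair t y) \<longleftrightarrow> baire_fst (baire_snd t) n \<noteq> 0 \<and>
     n = list_encode (initial_segment (baire_pair (baire_snd (baire_snd t)) y) (length (list_decode n)))"
proof -
  let ?z = "baire_pair (baire_snd (baire_snd t)) y"
  have "baire_pair t y (8 * n + 2) = baire_fst (baire_snd t) n"
    by (simp add: baire_pair_def baire_fst_def baire_snd_def)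
  moreover have "baire_pair t y (if even i then 4 * i + 6 else i) = ?z i" for i
    by (auto simp: baire_pair_def baire_fst_def baire_snd_def elim!: evenE intro!: arg_cong[of _ _ t])
  moreover have "(\<forall>i<length (list_decode n). entry (list_decode n) i = ?z i) \<longleftrightarrow>
      list_decode n = initial_segment ?z (length (list_decode n))"
    by (metis entry_initial_segment initial_segment_eqI)
  moreover have "\<dots> \<longleftrightarrow> n = list_encode (initial_segment ?z (length (list_decode n)))"
    by (metis list_decode_inverse list_encode_inverse)
  ultimately show ?thesis
    by (simp add: baire_hit_def)
qed

lemma baire_evaluate_yields:
  assumes "assoc_yields (baire_fst (baire_snd t)) (baire_pair (baire_snd (baire_snd t)) y) v"
  shows "\<exists>s. baire_evaluate (baire_pair t y) = Some s \<and>
    assoc_yields (baire_fst (baire_snd t)) (baire_pair (baire_snd (baire_snd t)) y) (s 0)"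
proof -
  let ?z = "baire_pair (baire_snd (baire_snd t)) y"
  obtain m where "baire_fst (baire_snd t) (list_encode (initial_segment ?z m)) \<noteq> 0"
    using assms by (auto simp: assoc_yields_def)
  then have ex: "baire_hit (list_encode (initial_segment ?z m)) (baire_pair t y)"
    by (simp add: baire_hit_pair list_encode_inverse)
  define n where "n = (LEAST n. baire_hit n (baire_pair t y))"
  have "baire_hit n (baire_pair t y)"
    unfolding n_def by (rule LeastI) (rule ex)
  then have "baire_fst (baire_snd t) n \<noteq> 0"
    "n = list_encode (initial_segment ?z (length (list_decode n)))"
    by (auto simp: baire_hit_pair)
  then have "assoc_yields (baire_fst (baire_snd t)) ?z (fst (prod_decode (baire_fst (baire_snd t) n - 1)))"
    unfolding assoc_yields_def by metis
  moreover have "baire_pair t y (8 * n + 2) = baire_fst (baire_snd t) n"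
    by (simp add: baire_pair_def baire_fst_def baire_snd_def)
  ultimately show ?thesis
    using ex by (auto simp: baire_evaluate_def n_def)
qed

lemma universal_problem_le: "weihrauch_le baire_rep nat_rep (universal_problem f) baire_rep baire_rep f"
  unfolding weihrauch_le_def
proof (intro exI conjI)
  show "computable_partial (\<lambda>t. Some (baire_fst t))" by (rule computable_baire_fst)
  show "computable_partial2 (\<lambda>(t, y). baire_evaluate (baire_pair t y))"
    unfolding computable_partial2_def using computable_baire_evaluate by auto
  show "reduces_via baire_rep nat_rep (universal_problem f) baire_rep baire_rep f
      (\<lambda>t. Some (baire_fst t)) (\<lambda>(t, y). baire_evaluate (baire_pair t y))"
    unfolding reduces_via_baire_iff
  proof (intro allI impI, elim conjE)
    fix t x assume "baire_rep t = Some x" "x \<in> mv_dom (universal_problem f)"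
    then have t: "t \<in> mv_dom (universal_problem f)" "x = t" by (auto simp: baire_rep_def)
    then have q: "baire_fst t \<in> mv_dom f"
      and y: "\<And>y. y \<in> f (baire_fst t) \<Longrightarrow>
        \<exists>v. assoc_yields (baire_fst (baire_snd t)) (baire_pair (baire_snd (baire_snd t)) y) v"
      by (auto simp: mv_dom_def universal_problem_def Let_def split: if_splits)
    have "\<exists>s v. baire_evaluate (baire_pair t y) = Some s \<and> nat_rep s = Some v \<and> v \<in> universal_problem f t"
      if "y \<in> f (baire_fst t)" for y
    proof -
      obtain v where "assoc_yields (baire_fst (baire_snd t)) (baire_pair (baire_snd (baire_snd t)) y) v"
        using y \<open>y \<in> f (baire_fst t)\<close> by blast
      then obtain s where "baire_evaluate (baire_pair t y) = Some s"
        "assoc_yields (baire_fst (baire_snd t)) (baire_pair (baire_snd (baire_snd t)) y) (s 0)"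
        using baire_evaluate_yields by blast
      with q y that show ?thesis
        by (auto simp: nat_rep_def universal_problem_def Let_def)
    qed
    with q t(2) show "\<exists>q. Some (baire_fst t) = Some q \<and> q \<in> mv_dom f \<and>
        (\<forall>r y. baire_rep r = Some y \<and> y \<in> f q \<longrightarrow>
          (\<exists>s v. (case (t, r) of (t, y) \<Rightarrow> baire_evaluate (baire_pair t y)) = Some s \<and>
             nat_rep s = Some v \<and> v \<in> universal_problem f x))"
      by (auto simp: baire_rep_def)
  qed
qed

text \<open>The word function \<open>k\<close> behind the outer reduction is tabulated as
  \<open>b\<close>, and the inner reduction adds this table to the instance; as \<open>k\<close> is
  recursive, a machine can write the table out. All nonempty words that \<open>k\<close> emits on
  prefixes of \<open>baire_pair p y\<close> begin with the same number, a solution of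
  \<open>g\<close>, so the new outer reduction only passes the answer on.\<close>

lemma universal_problem_ge:
  assumes "weihrauch_le baire_rep nat_rep g baire_rep baire_rep f"
  shows "weihrauch_le baire_rep nat_rep g baire_rep nat_rep (universal_problem f)"
proof -
  obtain H K where H: "computable_partial H" and "computable_partial2 K"
    and red: "reduces_via baire_rep nat_rep g baire_rep baire_rep f H K"
    using assms unfolding weihrauch_le_def by blast
  then obtain F where F: "computable_partial F" "\<And>p q. K (p, q) = F (baire_pair p q)"
    unfolding computable_partial2_def by blast
  obtain k where k: "recursive_word_fun k"
    and k_seg: "\<And>p q n. F p = Some q \<Longrightarrow> \<exists>m. k (initial_segment p n) = initial_segment q m"
    and k_len: "\<And>p q m. F p = Some q \<Longrightarrow> \<exists>n. m \<le> length (k (initial_segment p n))"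
    using F(1) unfolding computable_partial_def by metis
  obtain h where h: "recursive_word_fun h"
    and h_mono: "\<And>u v. prefix u v \<Longrightarrow> prefix (h u) (h v)"
    and h_seg: "\<And>p q n. H p = Some q \<Longrightarrow> \<exists>m. h (initial_segment p n) = initial_segment q m"
    and h_len: "\<And>p q m. H p = Some q \<Longrightarrow> \<exists>n. m \<le> length (h (initial_segment p n))"
    using H unfolding computable_partial_def by metis
  define b where "b n = list_encode (k (list_decode n))" for n
  define P where "P p = map_option (\<lambda>q. baire_pair q (baire_pair b p)) (H p)" for p
  have rec_b: "recf n (\<lambda>xs. b (A xs))" if "recf n A" for n A
    using recf_comp1[OF recursive_word_funD[OF k] that] by (simp add: b_def)
  have rec_h: "recf n (\<lambda>xs. list_encode (h (list_decode (A xs))))" if "recf n A" for n A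
    using recf_comp1[OF recursive_word_funD[OF h] that] by simp
  have rec_he: "recf n (\<lambda>xs. entry (h (list_decode (A xs))) (B xs))" if "recf n A" "recf n B" for n A B
    using recf_entry[OF rec_h[OF that(1)] that(2)] by (simp add: list_encode_inverse)
  have rec_hl: "recf n (\<lambda>xs. length (h (list_decode (A xs))))" if "recf n A" for n A
    using recf_length[OF rec_h[OF that(1)]] by (simp add: list_encode_inverse)
  \<comment> \<open>The output interleaves \<open>q\<close> with the pair of \<open>b\<close> and
    \<open>p\<close>. An even position below \<open>2 * length (h u)\<close> is covered by the word
    \<open>h u\<close>, an entry of \<open>p\<close> by the letters of \<open>u\<close>, and an
    entry of \<open>b\<close> needs no input, so the minimum of the two bounds is safe.\<close>
  define L where "L u = (if 2 * length (h u) \<le> length u then 2 * length (h u) else length u)" for u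
  define E where "E j u = (if even j then entry (h u) (j div 2)
      else if even (j div 2) then b (j div 4) else entry u (j div 4))" for j u
  have "computable_partial P"
  proof (rule computable_partialI[where L = L and E = E])
    show "recf 1 (\<lambda>xs. L (list_decode (xs ! 0)))"
      unfolding L_def by (intro recf_intros rec_hl; simp)
    show "recf 2 (\<lambda>xs. E (xs ! 0) (list_decode (xs ! 1)))"
      unfolding E_def by (intro recf_intros rec_he rec_b; simp)
    show "L u \<le> L v" if "prefix u v" for u v
      using prefix_length_le[OF that] prefix_length_le[OF h_mono[OF that]] by (auto simp: L_def)
    show "E i v = E i u" if "prefix u v" "i < L u" for u v i
      using that entry_prefix[OF that(1), of "i div 4"] entry_prefix[OF h_mono[OF that(1)], of "i div 2"]
      by (auto simp: L_def E_def split: if_splits)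
    show "E i (initial_segment p n) = t i" if "P p = Some t" "i < L (initial_segment p n)" for p t n i
    proof -
      obtain q where q: "H p = Some q" "t = baire_pair q (baire_pair b p)"
        using \<open>P p = Some t\<close> by (auto simp: P_def)
      obtain m where m: "h (initial_segment p n) = initial_segment q m"
        using h_seg[OF q(1)] by blast
      show ?thesis
        using that(2) m entry_initial_segment[of "i div 2" m q] entry_initial_segment[of "i div 4" n p]
        by (auto simp: L_def E_def q(2) baire_pair_def div_mult2_eq[of i 2 2, simplified] split: if_splits)
    qed
    show "\<exists>n. m \<le> L (initial_segment p n)" if "P p = Some t" for p t m
    proof -
      obtain q where q: "H p = Some q" using \<open>P p = Some t\<close> by (auto simp: P_def)
      obtain n where n: "m \<le> length (h (initial_segment p n))"
        using h_len[OF q] by blast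
      have "prefix (initial_segment p n) (initial_segment p (n + m))"
        by (simp add: initial_segment_def upt_add_eq_append[of 0 n m])
      from prefix_length_le[OF h_mono[OF this]] n
      show ?thesis by (intro exI[of _ "n + m"]) (auto simp: L_def)
    qed
  qed
  moreover have "computable_partial2 (\<lambda>(p, r). Some r)"
    unfolding computable_partial2_def using computable_baire_snd
    by (intro exI[of _ "\<lambda>t. Some (baire_snd t)"]) auto
  moreover have "reduces_via baire_rep nat_rep g baire_rep nat_rep (universal_problem f) P (\<lambda>(p, r). Some r)"
    unfolding reduces_via_nat_iff
  proof (intro allI impI, elim conjE)
    fix p x assume "baire_rep p = Some x" and x: "x \<in> mv_dom g"
    then have px: "baire_rep p = Some p" "p \<in> mv_dom g" "x = p" by (auto simp: baire_rep_def)
    obtain q where q: "H p = Some q" "q \<in> mv_dom f"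
      and Kv: "\<And>y. y \<in> f q \<Longrightarrow> \<exists>s v. K (p, y) = Some s \<and> nat_rep s = Some v \<and> v \<in> g p"
      using red[unfolded reduces_via_baire_iff, rule_format, OF conjI, OF px(1,2)]
      by (auto simp: baire_rep_def)
    have yields: "\<exists>v. assoc_yields b (baire_pair p y) v" and
      sound: "\<And>v. assoc_yields b (baire_pair p y) v \<Longrightarrow> v \<in> g p" if y: "y \<in> f q" for y
    proof -
      obtain s where s: "F (baire_pair p y) = Some s" "s 0 \<in> g p"
        using Kv[OF y] by (auto simp: F(2) nat_rep_def)
      obtain n where "1 \<le> length (k (initial_segment (baire_pair p y) n))"
        using k_len[OF s(1)] by blast
      then have "b (list_encode (initial_segment (baire_pair p y) n)) \<noteq> 0"
        by (cases "k (initial_segment (baire_pair p y) n)") (auto simp: b_def list_encode_inverse)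
      then show "\<exists>v. assoc_yields b (baire_pair p y) v"
        unfolding assoc_yields_def by blast
      fix v assume "assoc_yields b (baire_pair p y) v"
      then obtain n where n: "list_encode (k (initial_segment (baire_pair p y) n)) \<noteq> 0"
        "v = fst (prod_decode (list_encode (k (initial_segment (baire_pair p y) n)) - 1))"
        by (auto simp: assoc_yields_def b_def list_encode_inverse)
      obtain m where m: "k (initial_segment (baire_pair p y) n) = initial_segment s m"
        using k_seg[OF s(1)] by blast
      with n have "m \<noteq> 0" by (cases m) (auto simp: initial_segment_def)
      then have "initial_segment s m = s 0 # map s [1..<m]"
        by (simp add: initial_segment_def upt_conv_Cons)
      with n m have "v = s 0" by simp
      with s show "v \<in> g p" by simp
    qed
    have "baire_pair q (baire_pair b p) \<in> mv_dom (universal_problem f)"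
      using q(2) yields by (simp add: mv_dom_universal_problem)
    moreover have "v \<in> g p" if "v \<in> universal_problem f (baire_pair q (baire_pair b p))" for v
      using universal_problemD[OF that] sound by blast
    ultimately show "\<exists>q. P p = Some q \<and> q \<in> mv_dom (universal_problem f) \<and>
        (\<forall>r y. nat_rep r = Some y \<and> y \<in> universal_problem f q \<longrightarrow>
          (\<exists>s v. (case (p, r) of (p, r) \<Rightarrow> Some r) = Some s \<and> nat_rep s = Some v \<and> v \<in> g x))"
      using q px(3) by (auto simp: P_def)
  qed
  ultimately show ?thesis
    unfolding weihrauch_le_def by blast
qed

lemma is_first_order_part_first_order_part: "is_first_order_part f (first_order_part f)"
proof -
  have "is_first_order_part f (universal_problem f)"
    unfolding is_first_order_part_def using universal_problem_le universal_problem_ge by blast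
  then show ?thesis
    unfolding first_order_part_def by (rule someI[where P = "is_first_order_part f"])
qed

section \<open>Continuity on Baire space\<close>

lemma open_cylinder: "open {q. initial_segment q k = initial_segment p k}"
proof -
  have "{q. initial_segment q k = initial_segment p k} = (\<Inter>i<k. (\<lambda>q. q i) -` {p i})"
    by (auto simp: initial_segment_eq_iff)
  moreover have "open ((\<lambda>q::baire. q i) -` {p i})" for i
    by (intro open_vimage continuous_on_product_coordinates) (simp add: open_discrete)
  ultimately show ?thesis by auto
qed

lemma open_contains_cylinder:
  assumes "open U" "p \<in> U"
  shows "\<exists>k. {q. initial_segment q k = initial_segment p k} \<subseteq> U"
proof -
  have "openin (product_topology (\<lambda>i. euclidean) UNIV) U"
    using assms(1) by (simp add: open_fun_def)
  then obtain V where V: "p \<in> PiE UNIV V" "finite {i. V i \<noteq> UNIV}" "PiE UNIV V \<subseteq> U"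
    using product_topology_open_contains_basis[of "\<lambda>i. euclidean" UNIV U p] assms(2) by auto
  obtain k where k: "\<And>i. V i \<noteq> UNIV \<Longrightarrow> i < k"
    using V(2) by (metis (mono_tags, lifting) finite_nat_bounded lessThan_iff mem_Collect_eq subsetD)
  have "q \<in> PiE UNIV V" if q: "initial_segment q k = initial_segment p k" for q
  proof -
    have "q i \<in> V i" for i
      using q V(1) k[of i] by (cases "V i = UNIV") (auto simp: initial_segment_eq_iff PiE_def Pi_def)
    then show ?thesis by auto
  qed
  with V(3) show ?thesis by blast
qed

text \<open>Continuity into Baire space is continuity of every coordinate, with discrete values. The
  neighbourhood base \<open>B\<close> is kept abstract to serve both Baire space and its
  square.\<close>

lemma continuous_partial_iff_neighbourhoods:
  fixes F :: "'a::topological_space \<rightharpoonup> baire"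
  assumes B: "\<And>x k. open (B x k)" "\<And>x k. x \<in> B x k" "\<And>U x. open U \<Longrightarrow> x \<in> U \<Longrightarrow> \<exists>k. B x k \<subseteq> U"
  shows "continuous_partial F \<longleftrightarrow>
    (\<forall>x q n. F x = Some q \<longrightarrow> (\<exists>k::nat. \<forall>x' q'. F x' = Some q' \<and> x' \<in> B x k \<longrightarrow> q' n = q n))"
proof
  assume "continuous_partial F"
  then have "continuous_on (dom F) (\<lambda>x. the (F x) n)" for n
    unfolding continuous_partial_def by (rule continuous_on_product_then_coordinatewise)
  then have *: "\<exists>A. open A \<and> x \<in> A \<and> (\<forall>y\<in>dom F. y \<in> A \<longrightarrow> the (F y) n \<in> {the (F x) n})"
    if "x \<in> dom F" for x n
    using that unfolding continuous_on_topological by (meson open_discrete singletonI)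
  show "\<forall>x q n. F x = Some q \<longrightarrow> (\<exists>k. \<forall>x' q'. F x' = Some q' \<and> x' \<in> B x k \<longrightarrow> q' n = q n)"
  proof (intro allI impI)
    fix x q n assume q: "F x = Some q"
    then obtain A where "open A" "x \<in> A" "\<forall>y\<in>dom F. y \<in> A \<longrightarrow> the (F y) n = the (F x) n"
      using *[of x n] by blast
    moreover from this obtain k where "B x k \<subseteq> A" using B(3) by blast
    ultimately show "\<exists>k. \<forall>x' q'. F x' = Some q' \<and> x' \<in> B x k \<longrightarrow> q' n = q n"
      using q by (intro exI[of _ k]) (metis domI option.sel subsetD)
  qed
next
  assume R: "\<forall>x q n. F x = Some q \<longrightarrow> (\<exists>k. \<forall>x' q'. F x' = Some q' \<and> x' \<in> B x k \<longrightarrow> q' n = q n)"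
  have "continuous_on (dom F) (\<lambda>x. the (F x) n)" for n
    unfolding continuous_on_topological
  proof (intro ballI allI impI)
    fix x V assume x: "x \<in> dom F" and V: "the (F x) n \<in> V"
    then obtain k where "\<forall>x' q'. F x' = Some q' \<and> x' \<in> B x k \<longrightarrow> q' n = the (F x) n"
      using R by fastforce
    with B V show "\<exists>A. open A \<and> x \<in> A \<and> (\<forall>y\<in>dom F. y \<in> A \<longrightarrow> the (F y) n \<in> V)"
      by (intro exI[of _ "B x k"]) auto
  qed
  then show "continuous_partial F"
    unfolding continuous_partial_def by (rule continuous_on_coordinatewise_then_product)
qed

lemma continuous_partial_baire_iff:
  fixes F :: "baire \<rightharpoonup> baire"
  shows "continuous_partial F \<longleftrightarrow> (\<forall>p q n. F p = Some q \<longrightarrow> (\<exists>k. \<forall>p' q'. F p' = Some q' \<and>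
    initial_segment p' k = initial_segment p k \<longrightarrow> q' n = q n))"
  using continuous_partial_iff_neighbourhoods[of "\<lambda>p k. {q. initial_segment q k = initial_segment p k}" F]
    open_cylinder open_contains_cylinder by simp

lemma continuous_partial_pair_iff:
  fixes F :: "baire \<times> baire \<rightharpoonup> baire"
  shows "continuous_partial F \<longleftrightarrow> (\<forall>p r q n. F (p, r) = Some q \<longrightarrow> (\<exists>k. \<forall>p' r' q'. F (p', r') = Some q' \<and>
    initial_segment p' k = initial_segment p k \<and> initial_segment r' k = initial_segment r k \<longrightarrow> q' n = q n))"
proof -
  let ?C = "\<lambda>p k. {q. initial_segment q k = initial_segment p k}"
  let ?B = "\<lambda>x k. ?C (fst x) k \<times> ?C (snd x) k"
  have "\<exists>k. ?B x k \<subseteq> U" if U: "open U" "x \<in> U" for U :: "(baire \<times> baire) set" and x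
  proof -
    obtain A C where AC: "open A" "open C" "x \<in> A \<times> C" "A \<times> C \<subseteq> U"
      using U by (rule open_prod_elim)
    obtain i where i: "?C (fst x) i \<subseteq> A" using AC open_contains_cylinder[of A "fst x"] by auto
    obtain j where j: "?C (snd x) j \<subseteq> C" using AC open_contains_cylinder[of C "snd x"] by auto
    have "?C (fst x) (max i j) \<subseteq> A" "?C (snd x) (max i j) \<subseteq> C"
      using i j by (auto dest: initial_segment_antimono[where n = "max i j" and m = i]
          initial_segment_antimono[where n = "max i j" and m = j])
    then show ?thesis using AC(4) by (intro exI[of _ "max i j"]) blast
  qed
  then show ?thesis
    using continuous_partial_iff_neighbourhoods[of ?B F] open_cylinder
    by (simp add: open_Times mem_Times_iff)
qed

lemma continuous_partial_baire_coordD: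
  fixes F :: "baire \<rightharpoonup> baire"
  shows "continuous_partial F \<Longrightarrow> F p = Some q \<Longrightarrow>
    \<exists>k. \<forall>p' q'. F p' = Some q' \<and> initial_segment p' k = initial_segment p k \<longrightarrow> q' n = q n"
  unfolding continuous_partial_baire_iff by blast

lemma continuous_partial_pair_coordD:
  fixes F :: "baire \<times> baire \<rightharpoonup> baire"
  shows "continuous_partial F \<Longrightarrow> F (p, r) = Some q \<Longrightarrow>
    \<exists>k. \<forall>p' r' q'. F (p', r') = Some q' \<and> initial_segment p' k = initial_segment p k \<and>
      initial_segment r' k = initial_segment r k \<longrightarrow> q' n = q n"
  unfolding continuous_partial_pair_iff by blast

lemma continuous_partial_baire_segmentD:
  "continuous_partial F \<Longrightarrow> F p = Some q \<Longrightarrow> \<exists>k. \<forall>p' q'. F p' = Some q' \<and>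
    initial_segment p' k = initial_segment p k \<longrightarrow> initial_segment q' n = initial_segment (q::baire) n"
proof (induction n)
  case (Suc n)
  then obtain k where k: "\<forall>p' q'. F p' = Some q' \<and>
    initial_segment p' k = initial_segment p k \<longrightarrow> initial_segment q' n = initial_segment (q::baire) n"
    by blast
  obtain j where j: "\<forall>p' q'. F p' = Some q' \<and> initial_segment p' j = initial_segment p j \<longrightarrow> q' n = q n"
    using Suc.prems continuous_partial_baire_iff[of F] by blast
  show ?case
  proof (intro exI[of _ "max j k"] allI impI, elim conjE)
    fix p' q' assume *: "F p' = Some q'" "initial_segment p' (max j k) = initial_segment p (max j k)"
    have "initial_segment p' j = initial_segment p j" "initial_segment p' k = initial_segment p k"
      using *(2) by (auto intro: initial_segment_antimono)
    with * j k have "initial_segment q' n = initial_segment q n" "q' n = q n" by blast+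
    then show "initial_segment q' (Suc n) = initial_segment q (Suc n)"
      by (simp add: initial_segment_def)
  qed
qed (simp add: initial_segment_def)

lemma continuous_partial_compose:
  fixes H G :: "baire \<rightharpoonup> baire" and K :: "baire \<times> baire \<rightharpoonup> baire"
  assumes H: "continuous_partial H" and G: "continuous_partial G" and K: "continuous_partial K"
  shows "continuous_partial (\<lambda>p. Option.bind (H p) (\<lambda>q. Option.bind (G q) (\<lambda>r. K (p, r))))"
  unfolding continuous_partial_baire_iff
proof (intro allI impI)
  fix p s n assume "Option.bind (H p) (\<lambda>q. Option.bind (G q) (\<lambda>r. K (p, r))) = Some s"
  then obtain q r where q: "H p = Some q" and r: "G q = Some r" and s: "K (p, r) = Some s"
    by (auto simp: bind_eq_Some_conv)
  obtain k where k: "\<And>p' r' s'. K (p', r') = Some s' \<Longrightarrow> initial_segment p' k = initial_segment p k \<Longrightarrow>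
      initial_segment r' k = initial_segment r k \<Longrightarrow> s' n = s n"
    using continuous_partial_pair_coordD[where n = n, OF K s] by blast
  obtain j where j: "\<And>q' r'. G q' = Some r' \<Longrightarrow> initial_segment q' j = initial_segment q j \<Longrightarrow>
      initial_segment r' k = initial_segment r k"
    using continuous_partial_baire_segmentD[OF G r] by blast
  obtain i where i: "\<And>p' q'. H p' = Some q' \<Longrightarrow> initial_segment p' i = initial_segment p i \<Longrightarrow>
      initial_segment q' j = initial_segment q j"
    using continuous_partial_baire_segmentD[OF H q] by blast
  show "\<exists>m. \<forall>p' s'. Option.bind (H p') (\<lambda>q. Option.bind (G q) (\<lambda>r. K (p', r))) = Some s' \<and>
      initial_segment p' m = initial_segment p m \<longrightarrow> s' n = s n"
  proof (intro exI[of _ "max i k"] allI impI, elim conjE)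
    fix p' s'
    assume "Option.bind (H p') (\<lambda>q. Option.bind (G q) (\<lambda>r. K (p', r))) = Some s'"
      and *: "initial_segment p' (max i k) = initial_segment p (max i k)"
    then obtain q' r' where "H p' = Some q'" "G q' = Some r'" "K (p', r') = Some s'"
      by (auto simp: bind_eq_Some_conv)
    moreover have "initial_segment p' i = initial_segment p i" "initial_segment p' k = initial_segment p k"
      using * by (auto intro: initial_segment_antimono)
    ultimately show "s' n = s n" using i j k by blast
  qed
qed

lemma computable_partial_imp_continuous:
  assumes "computable_partial F"
  shows "continuous_partial F"
  unfolding continuous_partial_baire_iff
proof (intro allI impI)
  fix p q n assume q: "F p = Some q"
  obtain h where h: "\<And>p q n. F p = Some q \<Longrightarrow> \<exists>m. h (initial_segment p n) = initial_segment q m"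
    "\<And>p q m. F p = Some q \<Longrightarrow> \<exists>n. m \<le> length (h (initial_segment p n))"
    using assms unfolding computable_partial_def by metis
  obtain k where k: "Suc n \<le> length (h (initial_segment p k))" using h(2)[OF q] by blast
  show "\<exists>k. \<forall>p' q'. F p' = Some q' \<and> initial_segment p' k = initial_segment p k \<longrightarrow> q' n = q n"
  proof (intro exI[of _ k] allI impI, elim conjE)
    fix p' q' assume q': "F p' = Some q'" and eq: "initial_segment p' k = initial_segment p k"
    obtain m where m: "h (initial_segment p k) = initial_segment q m" using h(1)[OF q] by blast
    obtain m' where m': "h (initial_segment p k) = initial_segment q' m'" using h(1)[OF q', of k] eq by auto
    have "m = m'" using m m' by (metis length_initial_segment)
    then show "q' n = q n" using m m' k by (auto simp: initial_segment_eq_iff)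
  qed
qed

lemma computable_partial2_imp_continuous:
  assumes "computable_partial2 K"
  shows "continuous_partial K"
  unfolding continuous_partial_pair_iff
proof (intro allI impI)
  fix p r q n assume q: "K (p, r) = Some q"
  obtain F where F: "computable_partial F" "\<And>p q. K (p, q) = F (baire_pair p q)"
    using assms unfolding computable_partial2_def by blast
  obtain k where k: "\<And>t q'. F t = Some q' \<Longrightarrow> initial_segment t k = initial_segment (baire_pair p r) k \<Longrightarrow> q' n = q n"
    using continuous_partial_baire_coordD[OF computable_partial_imp_continuous[OF F(1)], of "baire_pair p r" q n] q by (auto simp: F(2))
  have "initial_segment (baire_pair p' r') k = initial_segment (baire_pair p r) k"
    if "initial_segment p' k = initial_segment p k" "initial_segment r' k = initial_segment r k" for p' r'
    using that by (auto simp: initial_segment_eq_iff baire_pair_def)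
  with k show "\<exists>k. \<forall>p' r' q'. K (p', r') = Some q' \<and> initial_segment p' k = initial_segment p k \<and>
      initial_segment r' k = initial_segment r k \<longrightarrow> q' n = q n"
    unfolding F(2) by (intro exI[of _ k]) blast
qed

lemma weihrauch_le_imp_continuous_weihrauch_le:
  "weihrauch_le dX dY g dZ dW h \<Longrightarrow> continuous_weihrauch_le dX dY g dZ dW h"
  unfolding weihrauch_le_def continuous_weihrauch_le_def
  using computable_partial_imp_continuous computable_partial2_imp_continuous by blast

lemma mv_continuous_mono:
  assumes "continuous_weihrauch_le dX dY g dZ dW h" "mv_continuous dZ dW h"
  shows "mv_continuous dX dY g"
  using assms continuous_partial_compose
  unfolding continuous_weihrauch_le_def mv_continuous_def reduces_via_def by blast

text \<open>Transfers continuity from the unknown chosen representative to the concrete problem,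
  where associates can be plugged in.\<close>

lemma mv_continuous_first_order_part_imp_universal_problem:
  assumes "mv_continuous baire_rep nat_rep (first_order_part f)"
  shows "mv_continuous baire_rep nat_rep (universal_problem f)"
proof (rule mv_continuous_mono[OF _ assms])
  show "continuous_weihrauch_le baire_rep nat_rep (universal_problem f) baire_rep nat_rep (first_order_part f)"
    using is_first_order_part_first_order_part[of f] universal_problem_le[of f]
      weihrauch_le_imp_continuous_weihrauch_le
    unfolding is_first_order_part_def by blast
qed

section \<open>Discontinuity and \<open>ACC_nat\<close>\<close>

text \<open>While the enumeration lists nothing, a continuous realizer commits itself to a number
  after finitely many zeros. Listing that very number next makes the commitment wrong.\<close>

lemma not_mv_continuous_ACC_nat: "\<not> mv_continuous enum_rep nat_rep ACC_nat"
proof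
  assume "mv_continuous enum_rep nat_rep ACC_nat"
  then obtain G where G: "continuous_partial G" "realizes enum_rep nat_rep G ACC_nat"
    unfolding mv_continuous_def by blast
  have val: "\<exists>q. G p = Some q \<and> (\<forall>k. p k \<noteq> Suc (q 0))" if "finite {n. \<exists>k. p k = Suc n}" "card {n. \<exists>k. p k = Suc n} \<le> 1" for p
  proof -
    let ?U = "{n. \<exists>k. p k = Suc n}"
    have U: "ACC_nat ?U = - ?U" using that by (simp add: ACC_nat_def)
    have "?U \<noteq> UNIV" using that(1) by auto
    then have "?U \<in> mv_dom ACC_nat" using U by (auto simp: mv_dom_def)
    then obtain q y where "G p = Some q" "nat_rep q = Some y" "y \<in> ACC_nat ?U"
      using G(2) unfolding realizes_def enum_rep_def by blast
    then show ?thesis unfolding U by (auto simp: nat_rep_def)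
  qed
  obtain q where q: "G (\<lambda>_. 0) = Some q"
    using val[of "\<lambda>_. 0"] by auto
  obtain k where k: "\<And>p' q'. G p' = Some q' \<Longrightarrow> initial_segment p' k = initial_segment (\<lambda>_. 0) k \<Longrightarrow> q' 0 = q 0"
    using continuous_partial_baire_coordD[where n = 0, OF G(1) q] by blast
  define p where "p i = (if i = k then Suc (q 0) else 0)" for i
  have U: "{n. \<exists>i. p i = Suc n} = {q 0}" by (auto simp: p_def)
  obtain q' where q': "G p = Some q'" "\<forall>i. p i \<noteq> Suc (q' 0)"
    using val[of p] unfolding U by auto
  have "initial_segment p k = initial_segment (\<lambda>_. 0) k"
    by (simp add: initial_segment_eq_iff p_def)
  from k[OF q'(1) this] q'(2)[rule_format, of k] show False by (simp add: p_def)
qed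

text \<open>A word receives a value when all results of \<open>K\<close> on its cylinder share their
  first entry; by continuity every point of the domain has such a prefix. A cylinder that misses the
  domain forces every value, and the arbitrary choice made there is harmless, since the claim
  concerns points of the domain only.\<close>

lemma ex_associate:
  fixes K :: "baire \<times> baire \<rightharpoonup> baire"
  assumes "continuous_partial K"
  shows "\<exists>b. \<forall>p y s. K (p, y) = Some s \<longrightarrow>
    (\<exists>v. assoc_yields b (baire_pair p y) v) \<and> (\<forall>v. assoc_yields b (baire_pair p y) v \<longrightarrow> v = s 0)"
proof -
  define forced where "forced w v \<longleftrightarrow>
    (\<forall>p y s. K (p, y) = Some s \<and> initial_segment (baire_pair p y) (length w) = w \<longrightarrow> s 0 = v)" for w v
  define b where "b m = (if \<exists>v. forced (list_decode m) v
    then Suc (prod_encode (SOME v. forced (list_decode m) v, 0)) else 0)" for m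
  have b: "b (list_encode w) \<noteq> 0 \<longleftrightarrow> (\<exists>v. forced w v)"
    "b (list_encode w) \<noteq> 0 \<Longrightarrow> forced w (fst (prod_decode (b (list_encode w) - 1)))" for w
    by (auto simp: b_def list_encode_inverse intro: someI split: if_splits)
  show ?thesis
  proof (intro exI[of _ b] allI impI conjI)
    fix p y s assume s: "K (p, y) = Some s"
    obtain k where k: "\<And>p' y' s'. K (p', y') = Some s' \<Longrightarrow> initial_segment p' k = initial_segment p k \<Longrightarrow>
      initial_segment y' k = initial_segment y k \<Longrightarrow> s' 0 = s 0"
      using continuous_partial_pair_coordD[where n = 0, OF assms s] by blast
    have "initial_segment p' k = initial_segment p k \<and> initial_segment y' k = initial_segment y k"
      if "initial_segment (baire_pair p' y') (2 * k) = initial_segment (baire_pair p y) (2 * k)" for p' y'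
    proof -
      have eq: "baire_pair p' y' i = baire_pair p y i" if "i < 2 * k" for i
        using \<open>initial_segment _ _ = _\<close> that unfolding initial_segment_eq_iff by blast
      have "p' i = p i" "y' i = y i" if "i < k" for i
        using eq[of "2 * i"] eq[of "Suc (2 * i)"] that by (auto simp: baire_pair_def)
      then show ?thesis by (simp add: initial_segment_eq_iff)
    qed
    then have "forced (initial_segment (baire_pair p y) (2 * k)) (s 0)"
      unfolding forced_def using k by (metis length_initial_segment)
    then show "\<exists>v. assoc_yields b (baire_pair p y) v"
      unfolding assoc_yields_def using b(1) by blast
    fix v assume "assoc_yields b (baire_pair p y) v"
    then obtain n where "forced (initial_segment (baire_pair p y) n) v"
      unfolding assoc_yields_def using b(2) by blast
    then show "v = s 0"
      unfolding forced_def using s by fastforce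
  qed
qed

lemma continuous_partial_pair_const:
  fixes H :: "baire \<rightharpoonup> baire"
  assumes "continuous_partial H"
  shows "continuous_partial (\<lambda>p. map_option (\<lambda>q. baire_pair q (baire_pair b p)) (H p))"
  unfolding continuous_partial_baire_iff
proof (intro allI impI)
  fix p t n assume "map_option (\<lambda>q. baire_pair q (baire_pair b p)) (H p) = Some t"
  then obtain q where q: "H p = Some q" "t = baire_pair q (baire_pair b p)" by auto
  obtain k where k: "\<And>p' q'. H p' = Some q' \<Longrightarrow> initial_segment p' k = initial_segment p k \<Longrightarrow>
      q' (n div 2) = q (n div 2)"
    using continuous_partial_baire_coordD[where n = "n div 2", OF assms q(1)] by blast
  show "\<exists>k. \<forall>p' q'. map_option (\<lambda>q. baire_pair q (baire_pair b p')) (H p') = Some q' \<and>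
      initial_segment p' k = initial_segment p k \<longrightarrow> q' n = t n"
  proof (intro exI[of _ "max k (Suc n)"] allI impI, elim conjE)
    fix p' t' assume "map_option (\<lambda>q. baire_pair q (baire_pair b p')) (H p') = Some t'"
      and *: "initial_segment p' (max k (Suc n)) = initial_segment p (max k (Suc n))"
    then obtain q' where q': "H p' = Some q'" "t' = baire_pair q' (baire_pair b p')" by auto
    have "initial_segment p' k = initial_segment p k" using * by (auto intro: initial_segment_antimono)
    moreover have "p' (n div 2 div 2) = p (n div 2 div 2)"
      using * by (simp add: initial_segment_eq_iff)
    ultimately show "t' n = t n" using k[OF q'(1)] by (simp add: q q' baire_pair_def)
  qed
qed

text \<open>The associate \<open>b\<close> of \<open>K\<close> is hard-wired into the inner
  reduction \<open>P\<close>, which has to be continuous only; the outer reduction returns the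
  answer unchanged.\<close>

lemma not_ACC_nat_le:
  assumes "mv_continuous baire_rep nat_rep (first_order_part f)"
  shows "\<not> continuous_weihrauch_le enum_rep nat_rep ACC_nat baire_rep baire_rep f"
proof
  assume "continuous_weihrauch_le enum_rep nat_rep ACC_nat baire_rep baire_rep f"
  then obtain H K where H: "continuous_partial H" and K: "continuous_partial K"
    and red: "reduces_via enum_rep nat_rep ACC_nat baire_rep baire_rep f H K"
    unfolding continuous_weihrauch_le_def by blast
  obtain b where b: "\<And>p y s. K (p, y) = Some s \<Longrightarrow> \<exists>v. assoc_yields b (baire_pair p y) v"
    "\<And>p y s v. K (p, y) = Some s \<Longrightarrow> assoc_yields b (baire_pair p y) v \<Longrightarrow> v = s 0"
    using ex_associate[OF K] by blast
  define P where "P p = map_option (\<lambda>q. baire_pair q (baire_pair b p)) (H p)" for p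
  have P: "continuous_partial P"
    unfolding P_def using H by (rule continuous_partial_pair_const)
  have snd: "continuous_partial (\<lambda>(p :: baire, r). Some r :: baire option)"
    unfolding continuous_partial_pair_iff by (auto simp: initial_segment_eq_iff)
  have "continuous_weihrauch_le enum_rep nat_rep ACC_nat baire_rep nat_rep (universal_problem f)"
    unfolding continuous_weihrauch_le_def
  proof (intro exI conjI, rule P, rule snd, unfold reduces_via_nat_iff, intro allI impI, elim conjE)
    fix p U assume U: "enum_rep p = Some U" "U \<in> mv_dom ACC_nat"
    obtain q where q: "H p = Some q" "q \<in> mv_dom f"
      and Kv: "\<And>y. y \<in> f q \<Longrightarrow> \<exists>s v. K (p, y) = Some s \<and> nat_rep s = Some v \<and> v \<in> ACC_nat U"
      using red[unfolded reduces_via_baire_iff, rule_format, OF conjI, OF U]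
      by (auto simp: baire_rep_def)
    have yields: "\<exists>v. assoc_yields b (baire_pair p y) v" and
      sound: "\<And>v. assoc_yields b (baire_pair p y) v \<Longrightarrow> v \<in> ACC_nat U" if "y \<in> f q" for y
      using Kv[OF that] b unfolding nat_rep_def by (blast, fastforce)
    have "baire_pair q (baire_pair b p) \<in> mv_dom (universal_problem f)"
      using q(2) yields by (simp add: mv_dom_universal_problem)
    moreover have "v \<in> ACC_nat U" if "v \<in> universal_problem f (baire_pair q (baire_pair b p))" for v
      using universal_problemD[OF that] sound by blast
    ultimately show "\<exists>q. P p = Some q \<and> q \<in> mv_dom (universal_problem f) \<and>
        (\<forall>r y. nat_rep r = Some y \<and> y \<in> universal_problem f q \<longrightarrow>
          (\<exists>s v. (case (p, r) of (p, r) \<Rightarrow> Some r) = Some s \<and> nat_rep s = Some v \<and> v \<in> ACC_nat U))"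
      using q by (auto simp: P_def)
  qed
  then show False
    using mv_continuous_mono mv_continuous_first_order_part_imp_universal_problem[OF assms]
      not_mv_continuous_ACC_nat by blast
qed

text \<open>Otherwise every point of the domain has a cylinder on which one number always solves
  \<open>g\<close>. Taking the least length \<open>m x\<close> and then the least number
  \<open>v x\<close> makes the choice locally constant: points sharing the first \<open>m x\<close>
  entries with \<open>x\<close> face the same conditions up to that length.\<close>

lemma discontinuity_point:
  assumes "\<not> mv_continuous baire_rep nat_rep g"
  shows "\<exists>x\<in>mv_dom g. \<forall>n k. \<exists>y\<in>mv_dom g. initial_segment y k = initial_segment x k \<and> n \<notin> g y"
proof (rule ccontr)
  assume contra: "\<not> ?thesis"
  define A where "A x k n \<longleftrightarrow> (\<forall>y\<in>mv_dom g. initial_segment y k = initial_segment x k \<longrightarrow> n \<in> g y)" for x k n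
  define m where "m x = (LEAST k. \<exists>n. A x k n)" for x
  define v where "v x = (LEAST n. A x (m x) n)" for x
  have A: "A x (m x) (v x)" if "x \<in> mv_dom g" for x
  proof -
    have "\<exists>k n. A x k n" using contra that unfolding A_def by blast
    then have "\<exists>n. A x (m x) n" unfolding m_def by (rule LeastI_ex)
    then show ?thesis unfolding v_def by (rule LeastI_ex)
  qed
  have A_cong: "A y j = A x j" if "initial_segment y k = initial_segment x k" "j \<le> k" for x y j k
    using initial_segment_antimono[OF that] by (auto simp: A_def fun_eq_iff)
  have v_eq: "v y = v x" if y: "initial_segment y (m x) = initial_segment x (m x)" and x: "x \<in> mv_dom g" for x y
  proof -
    have "m y = m x"
    proof (subst m_def, rule Least_equality)
      show "\<exists>n. A y (m x) n" using A[OF x] A_cong[OF y] by auto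
      show "m x \<le> j" if "\<exists>n. A y j n" for j
      proof (rule ccontr)
        assume "\<not> m x \<le> j"
        then have "\<exists>n. A x j n" using that A_cong[OF y, of j] by auto
        then have "m x \<le> j" unfolding m_def by (rule Least_le)
        with \<open>\<not> m x \<le> j\<close> show False by blast
      qed
    qed
    then show ?thesis using A_cong[OF y] by (simp add: v_def)
  qed
  define G where "G x = (if x \<in> mv_dom g then Some (\<lambda>_::nat. v x) else None)" for x
  have "continuous_partial G"
    unfolding continuous_partial_baire_iff
  proof (intro allI impI)
    fix p q n assume "G p = Some q"
    then have p: "p \<in> mv_dom g" "q = (\<lambda>_. v p)" by (auto simp: G_def split: if_splits)
    have "q' n = q n" if "G p' = Some q'" "initial_segment p' (m p) = initial_segment p (m p)" for p' q'
      using that(1) v_eq[OF that(2) p(1)] p(2) by (auto simp: G_def split: if_splits)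
    then show "\<exists>k. \<forall>p' q'. G p' = Some q' \<and> initial_segment p' k = initial_segment p k \<longrightarrow> q' n = q n"
      by blast
  qed
  moreover have "realizes baire_rep nat_rep G g"
    using A by (auto simp: realizes_def baire_rep_def nat_rep_def G_def A_def)
  ultimately show False using assms unfolding mv_continuous_def by blast
qed

section \<open>Convergent sequences and their closures\<close>

lemma baire_tendsto_iff:
  fixes a :: "nat \<Rightarrow> baire"
  shows "a \<longlonglongrightarrow> l \<longleftrightarrow> (\<forall>k. \<exists>N. \<forall>i\<ge>N. initial_segment (a i) k = initial_segment l k)"
proof
  assume a: "a \<longlonglongrightarrow> l"
  show "\<forall>k. \<exists>N. \<forall>i\<ge>N. initial_segment (a i) k = initial_segment l k"
    using topological_tendstoD[OF a open_cylinder[of _ l]] by (auto simp: eventually_sequentially)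
next
  assume *: "\<forall>k. \<exists>N. \<forall>i\<ge>N. initial_segment (a i) k = initial_segment l k"
  show "a \<longlonglongrightarrow> l"
  proof (rule topological_tendstoI)
    fix U assume "open U" "l \<in> U"
    then obtain k where "{q. initial_segment q k = initial_segment l k} \<subseteq> U"
      using open_contains_cylinder by blast
    with * show "eventually (\<lambda>i. a i \<in> U) sequentially"
      unfolding eventually_sequentially by blast
  qed
qed

lemma finite_set_separated:
  assumes "finite S"
  shows "\<exists>k. \<forall>z'\<in>S. initial_segment z' k = initial_segment z k \<longrightarrow> z' = z"
  using assms
proof (induction S)
  case (insert s S)
  then obtain k where k: "\<forall>z'\<in>S. initial_segment z' k = initial_segment z k \<longrightarrow> z' = z" by blast
  obtain j where j: "s \<noteq> z \<Longrightarrow> s j \<noteq> z j" by (metis ext)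
  show ?case
  proof (intro exI[of _ "max k (Suc j)"] ballI impI)
    fix z' assume z': "z' \<in> insert s S"
      and *: "initial_segment z' (max k (Suc j)) = initial_segment z (max k (Suc j))"
    have "initial_segment z' k = initial_segment z k" using * by (auto intro: initial_segment_antimono)
    moreover have "z' j = z j" using * by (simp add: initial_segment_eq_iff)
    ultimately show "z' = z" using z' j k by auto
  qed
qed simp

text \<open>At a coordinate where \<open>z\<close> differs from \<open>l\<close>, all but finitely
  many terms agree with \<open>l\<close>, and finitely many points can be separated from
  \<open>z\<close>. As \<open>z\<close> may lie outside the range, this yields closedness of the
  range with its limit as well as isolation.\<close>

lemma convergent_range_isolated:
  fixes a :: "nat \<Rightarrow> baire"
  assumes a: "a \<longlonglongrightarrow> l" and z: "z \<noteq> l"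
  shows "\<exists>k. \<forall>z'\<in>insert l (range a). initial_segment z' k = initial_segment z k \<longrightarrow> z' = z"
proof -
  obtain d where d: "z d \<noteq> l d" using z by (metis ext)
  obtain N where "\<And>i. i \<ge> N \<Longrightarrow> initial_segment (a i) (Suc d) = initial_segment l (Suc d)"
    using a unfolding baire_tendsto_iff by blast
  then have N: "\<And>i. i \<ge> N \<Longrightarrow> a i d = l d" by (simp add: initial_segment_eq_iff)
  obtain k where k: "\<forall>z'\<in>a ` {..<N}. initial_segment z' k = initial_segment z k \<longrightarrow> z' = z"
    using finite_set_separated[of "a ` {..<N}"] by blast
  show ?thesis
  proof (intro exI[of _ "max k (Suc d)"] ballI impI)
    fix z' assume z': "z' \<in> insert l (range a)"
      and *: "initial_segment z' (max k (Suc d)) = initial_segment z (max k (Suc d))"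
    have "initial_segment z' k = initial_segment z k" using * by (auto intro: initial_segment_antimono)
    moreover have "z' \<in> a ` {..<N}"
    proof -
      have zd: "z' d \<noteq> l d" using * d by (simp add: initial_segment_eq_iff)
      then obtain i where i: "z' = a i" using z' by auto
      with N[of i] zd have "i < N" by (cases "i < N") auto
      with i show ?thesis by blast
    qed
    ultimately show "z' = z" using k by blast
  qed
qed

lemma closure_range_convergent:
  fixes a :: "nat \<Rightarrow> baire"
  assumes "a \<longlonglongrightarrow> l"
  shows "closure (range a) = insert l (range a)"
proof
  have "open (- insert l (range a))"
  proof (subst open_subopen, intro ballI)
    fix z assume z: "z \<in> - insert l (range a)"
    then obtain k where "\<forall>z'\<in>insert l (range a). initial_segment z' k = initial_segment z k \<longrightarrow> z' = z"
      using convergent_range_isolated[OF assms, of z] by auto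
    with z show "\<exists>T. open T \<and> z \<in> T \<and> T \<subseteq> - insert l (range a)"
      by (intro exI[of _ "{q. initial_segment q k = initial_segment z k}"]) (auto simp: open_cylinder)
  qed
  then show "closure (range a) \<subseteq> insert l (range a)"
    by (intro closure_minimal) (auto simp: closed_def)
  have "l \<in> closure (range a)"
    using assms closure_subset[of "range a"]
    by (intro Lim_in_closed_set[OF closed_closure _ _ assms]) (auto intro: always_eventually)
  then show "insert l (range a) \<subseteq> closure (range a)"
    using closure_subset[of "range a"] by auto
qed

lemma discontinuous_first_order_part_imp_sequence:
  assumes "\<not> mv_continuous baire_rep nat_rep (first_order_part f)"
  shows "\<exists>a :: nat \<Rightarrow> baire. convergent a \<and> closure (range a) \<subseteq> mv_dom f \<and>
    \<not> mv_continuous baire_rep baire_rep (mv_restrict f (closure (range a)))"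
proof -
  define g where "g = first_order_part f"
  have "continuous_weihrauch_le baire_rep nat_rep g baire_rep baire_rep f"
    using is_first_order_part_first_order_part[of f] weihrauch_le_imp_continuous_weihrauch_le
    unfolding is_first_order_part_def g_def by blast
  then obtain H K where H: "continuous_partial H" and K: "continuous_partial K"
    and "reduces_via baire_rep nat_rep g baire_rep baire_rep f H K"
    unfolding continuous_weihrauch_le_def by blast
  then have red: "\<exists>q. H p = Some q \<and> q \<in> mv_dom f \<and> (\<forall>r\<in>f q. \<exists>s. K (p, r) = Some s \<and> s 0 \<in> g p)"
    if "p \<in> mv_dom g" for p
    using that unfolding reduces_via_baire_iff baire_rep_def nat_rep_def by auto
  obtain x where x: "x \<in> mv_dom g" and
    disc: "\<And>n k. \<exists>y\<in>mv_dom g. initial_segment y k = initial_segment x k \<and> n \<notin> g y"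
    using discontinuity_point[OF assms] unfolding g_def by blast
  \<comment> \<open>The index \<open>i\<close> codes a number to refute together with a distance. A
    pair code is at least its second component, so every number is refuted by terms arbitrarily
    close to \<open>x\<close>.\<close>
  have "\<forall>i. \<exists>y\<in>mv_dom g. initial_segment y i = initial_segment x i \<and> fst (prod_decode i) \<notin> g y"
    using disc by blast
  then obtain y where y: "\<And>i. y i \<in> mv_dom g" "\<And>i. initial_segment (y i) i = initial_segment x i"
    "\<And>i. fst (prod_decode i) \<notin> g (y i)"
    by metis
  define h where "h p = the (H p)" for p
  define a where "a i = h (y i)" for i
  have h: "H p = Some (h p)" "h p \<in> mv_dom f" if "p \<in> mv_dom g" for p
    using red[OF that] by (auto simp: h_def)
  have "a \<longlonglongrightarrow> h x"
    unfolding baire_tendsto_iff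
  proof
    fix n
    obtain k where k: "\<And>p' q'. H p' = Some q' \<Longrightarrow> initial_segment p' k = initial_segment x k \<Longrightarrow>
        initial_segment q' n = initial_segment (h x) n"
      using continuous_partial_baire_segmentD[OF H h(1)[OF x]] by blast
    show "\<exists>N. \<forall>i\<ge>N. initial_segment (a i) n = initial_segment (h x) n"
      using k[OF h(1)[OF y(1)]] initial_segment_antimono[OF y(2)] by (auto simp: a_def intro!: exI[of _ k])
  qed
  from closure_range_convergent[OF this] have cl: "closure (range a) = insert (h x) (range a)" .
  have "\<not> mv_continuous baire_rep baire_rep (mv_restrict f (closure (range a)))"
  proof
    assume "mv_continuous baire_rep baire_rep (mv_restrict f (closure (range a)))"
    then obtain G where G: "continuous_partial G"
      "realizes baire_rep baire_rep G (mv_restrict f (closure (range a)))"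
      unfolding mv_continuous_def by blast
    define M where "M = (\<lambda>p. Option.bind (H p) (\<lambda>q. Option.bind (G q) (\<lambda>r. K (p, r))))"
    have M: "continuous_partial M"
      unfolding M_def by (intro continuous_partial_compose H G K)
    have M_val: "\<exists>s. M p = Some s \<and> s 0 \<in> g p" if p: "p \<in> mv_dom g" "h p \<in> closure (range a)" for p
    proof -
      have "h p \<in> mv_dom (mv_restrict f (closure (range a)))"
        using h(2)[OF p(1)] p(2) by (auto simp: mv_dom_def mv_restrict_def)
      then obtain r where "G (h p) = Some r" "r \<in> mv_restrict f (closure (range a)) (h p)"
        using G(2) unfolding realizes_def baire_rep_def by blast
      moreover from this have "r \<in> f (h p)" using p(2) by (simp add: mv_restrict_def)
      ultimately show ?thesis using red[OF p(1)] h(1)[OF p(1)] by (auto simp: M_def)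
    qed
    obtain s where s: "M x = Some s" using M_val[OF x] cl by auto
    obtain k where k: "\<And>p' q'. M p' = Some q' \<Longrightarrow> initial_segment p' k = initial_segment x k \<Longrightarrow> q' 0 = s 0"
      using continuous_partial_baire_coordD[where n = 0, OF M s] by blast
    \<comment> \<open>This term lies in the cylinder of length \<open>k\<close> around
      \<open>x\<close>, where \<open>M\<close> is committed to \<open>s 0\<close>, and was chosen to
      refute \<open>s 0\<close>.\<close>
    let ?i = "prod_encode (s 0, k)"
    obtain s' where s': "M (y ?i) = Some s'" "s' 0 \<in> g (y ?i)"
      using M_val[OF y(1)] cl by (auto simp: a_def)
    have "initial_segment (y ?i) k = initial_segment x k"
      by (rule initial_segment_antimono[OF y(2) le_prod_encode_2])
    from k[OF s'(1) this] s'(2) y(3)[of ?i] show False by simp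
  qed
  moreover have "closure (range a) \<subseteq> mv_dom f"
    unfolding cl using h(2) x y(1) by (auto simp: a_def)
  ultimately show ?thesis using \<open>a \<longlonglongrightarrow> h x\<close> by (auto simp: convergent_def)
qed

text \<open>Arbitrarily close to \<open>l\<close> there are points of \<open>A\<close> at which every solution avoids the word \<open>w\<close>. If
  some solution at \<open>l\<close> had no such prefix, it would extend to a continuous realizer on \<open>A\<close>.\<close>

definition avoidable :: "(baire, baire) mvfun \<Rightarrow> baire set \<Rightarrow> baire \<Rightarrow> nat list \<Rightarrow> bool" where
  "avoidable f A l w \<longleftrightarrow>
     (\<forall>m. \<exists>z\<in>A. initial_segment z m = initial_segment l m \<and> (\<forall>y\<in>f z. initial_segment y (length w) \<noteq> w))"

lemma ex_avoidable_prefix: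
  fixes a :: "nat \<Rightarrow> baire"
  assumes a: "a \<longlonglongrightarrow> l" and A: "A = insert l (range a)" "A \<subseteq> mv_dom f"
    and disc: "\<not> mv_continuous baire_rep baire_rep (mv_restrict f A)" and b: "b \<in> f l"
  shows "\<exists>j. avoidable f A l (initial_segment b j)"
proof (rule ccontr)
  assume "\<not> ?thesis"
  then have "\<forall>j. \<exists>m. \<forall>z\<in>A. initial_segment z m = initial_segment l m \<longrightarrow>
      (\<exists>y\<in>f z. initial_segment y j = initial_segment b j)"
    unfolding avoidable_def by simp
  then obtain m where m: "\<And>j z. z \<in> A \<Longrightarrow> initial_segment z (m j) = initial_segment l (m j) \<Longrightarrow>
      \<exists>y\<in>f z. initial_segment y j = initial_segment b j"
    by metis
  \<comment> \<open>The lengths up to which a solution at \<open>z\<close> is required to follow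
    \<open>b\<close>. The second condition bounds them by the first difference between
    \<open>z\<close> and \<open>l\<close>: for infinitely many lengths there might be no single
    solution, whereas a maximal one serves all smaller ones.\<close>
  define J where "J z = {j. initial_segment z (m j) = initial_segment l (m j) \<and>
      initial_segment z j = initial_segment l j}" for z
  have "\<exists>y\<in>f z. \<forall>j\<in>J z. initial_segment y j = initial_segment b j" if z: "z \<in> A" for z
  proof (cases "z = l")
    case True
    with b show ?thesis by auto
  next
    case False
    then obtain d where d: "z d \<noteq> l d" by (metis ext)
    have "J z \<subseteq> {..d}"
    proof
      fix j assume "j \<in> J z"
      then have "\<forall>i<j. z i = l i" by (simp add: J_def initial_segment_eq_iff)
      with d show "j \<in> {..d}" by (metis atMost_iff not_le)
    qed
    then have fin: "finite (J z)" by (rule finite_subset) simp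
    show ?thesis
    proof (cases "J z = {}")
      case True
      then show ?thesis using z A(2) by (auto simp: mv_dom_def)
    next
      case False
      then have "Max (J z) \<in> J z" using fin by simp
      then obtain y where y: "y \<in> f z" "initial_segment y (Max (J z)) = initial_segment b (Max (J z))"
        using m[OF z] by (auto simp: J_def)
      then show ?thesis
        using initial_segment_antimono Max_ge[OF fin] by blast
    qed
  qed
  then obtain c where c: "\<And>z. z \<in> A \<Longrightarrow> c z \<in> f z"
    "\<And>z j. z \<in> A \<Longrightarrow> j \<in> J z \<Longrightarrow> initial_segment (c z) j = initial_segment b j"
    by metis
  define G where "G z = (if z \<in> A then Some (c z) else None)" for z
  have "\<exists>k. \<forall>z'\<in>A. initial_segment z' k = initial_segment z k \<longrightarrow> c z' n = c z n" if z: "z \<in> A" for z n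
  proof (cases "z = l")
    case True
    \<comment> \<open>Agreement with \<open>l\<close> up to this length puts \<open>Suc n\<close>
      into \<open>J z'\<close>, which fixes entry \<open>n\<close> of \<open>c z'\<close>.\<close>
    let ?k = "max (m (Suc n)) (Suc n)"
    have "c z' n = b n" if "z' \<in> A" "initial_segment z' ?k = initial_segment l ?k" for z'
    proof -
      have "Suc n \<in> J z'"
        using that(2) by (auto simp: J_def intro: initial_segment_antimono)
      from c(2)[OF that(1) this] show ?thesis by (simp add: initial_segment_eq_iff)
    qed
    with z True show ?thesis by (intro exI[of _ ?k]) auto
  next
    case False
    from convergent_range_isolated[OF a this] show ?thesis
      unfolding A(1) by metis
  qed
  then have "continuous_partial G"
    unfolding continuous_partial_baire_iff by (fastforce simp: G_def split: if_splits)
  moreover have "realizes baire_rep baire_rep G (mv_restrict f A)"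
    using c(1) by (auto simp: realizes_def baire_rep_def G_def mv_restrict_def mv_dom_def split: if_splits)
  ultimately show False using disc unfolding mv_continuous_def by blast
qed

text \<open>A search that succeeds by \<open>k\<close> depends only on the tests up to
  \<open>k\<close>. This gives continuity of the unbounded searches \<open>pos\<close> and
  \<open>out\<close> below.\<close>

lemma Least_cong_up_to:
  assumes "P p k" "\<And>j. j \<le> k \<Longrightarrow> P p' j = P p j"
  shows "(LEAST k. P p' k) = (LEAST k::nat. P p k)" "(LEAST k. P p k) \<le> k" "P p (LEAST k. P p k)"
proof -
  show le: "(LEAST k. P p k) \<le> k" by (rule Least_le[of "P p", OF assms(1)])
  show P: "P p (LEAST k. P p k)" by (rule LeastI[of "P p", OF assms(1)])
  show "(LEAST k. P p' k) = (LEAST k. P p k)"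
  proof (rule Least_equality)
    show "P p' (LEAST k. P p k)" using P assms(2)[OF le] by simp
    show "(LEAST k. P p k) \<le> j" if "P p' j" for j
    proof (cases "j \<le> k")
      case True
      then show ?thesis using that assms(2) by (intro Least_le) simp
    qed (use le in simp)
  qed
qed

lemma discontinuous_sequence_imp_ACC_nat_le:
  fixes a :: "nat \<Rightarrow> baire"
  assumes "convergent a" and sub: "closure (range a) \<subseteq> mv_dom f"
    and disc: "\<not> mv_continuous baire_rep baire_rep (mv_restrict f (closure (range a)))"
  shows "continuous_weihrauch_le enum_rep nat_rep ACC_nat baire_rep baire_rep f"
proof -
  obtain l where a: "a \<longlonglongrightarrow> l" using assms(1) by (auto simp: convergent_def)
  define A where "A = closure (range a)"
  have A: "A = insert l (range a)" "A \<subseteq> mv_dom f"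
    using closure_range_convergent[OF a] sub by (auto simp: A_def)
  define bad where "bad = avoidable f A l"
  have bad_prefix: "\<exists>j. bad (initial_segment b j)" if "b \<in> f l" for b
    unfolding bad_def by (rule ex_avoidable_prefix[OF a A disc[folded A_def] that])
  \<comment> \<open>The implication allows a total choice of \<open>z\<close>: for a word that is
    not avoidable, \<open>l\<close> itself is a placeholder.\<close>
  have "\<forall>n k. \<exists>z\<in>A. initial_segment z k = initial_segment l k \<and>
      (bad (list_decode n) \<longrightarrow> (\<forall>y\<in>f z. initial_segment y (length (list_decode n)) \<noteq> list_decode n))"
  proof (intro allI)
    fix n k
    show "\<exists>z\<in>A. initial_segment z k = initial_segment l k \<and>
      (bad (list_decode n) \<longrightarrow> (\<forall>y\<in>f z. initial_segment y (length (list_decode n)) \<noteq> list_decode n))"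
    proof (cases "bad (list_decode n)")
      case True
      then show ?thesis unfolding bad_def avoidable_def by metis
    next
      case False
      then show ?thesis using A(1) by auto
    qed
  qed
  then obtain z where z: "\<And>n k. z n k \<in> A" "\<And>n k. initial_segment (z n k) k = initial_segment l k"
    "\<And>n k y. bad (list_decode n) \<Longrightarrow> y \<in> f (z n k) \<Longrightarrow>
      initial_segment y (length (list_decode n)) \<noteq> list_decode n"
    by metis
  \<comment> \<open>\<open>H\<close> outputs \<open>l\<close> until \<open>p\<close> lists a number \<open>n\<close>, and then moves to a nearby point at which no
    solution extends the \<open>n\<close>-th word. \<open>K\<close> looks for an avoidable prefix of the solution and outputs its
    code, unless \<open>p\<close> lists some \<open>n\<close> earlier, in which case it outputs \<open>p k = Suc n \<noteq> n\<close>.\<close>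
  define pos where "pos p = (LEAST k. p k \<noteq> (0::nat))" for p :: baire
  define H where "H p = Some (if \<exists>k. p k \<noteq> 0 then z (p (pos p) - 1) (pos p) else l)" for p
  define stop where "stop x k \<longleftrightarrow> fst x k \<noteq> 0 \<or> bad (initial_segment (snd x) k)" for x :: "baire \<times> baire" and k
  define out where "out x = (LEAST k. stop x k)" for x
  define K where "K x = (if \<exists>k. stop x k then Some (\<lambda>_::nat. if fst x (out x) \<noteq> 0 then fst x (out x)
    else list_encode (initial_segment (snd x) (out x))) else None)" for x :: "baire \<times> baire"
  have "continuous_partial H"
    unfolding continuous_partial_baire_iff
  proof (intro allI impI)
    fix p q n assume q: "H p = Some q"
    show "\<exists>k. \<forall>p' q'. H p' = Some q' \<and> initial_segment p' k = initial_segment p k \<longrightarrow> q' n = q n"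
    proof (cases "\<exists>k. p k \<noteq> 0")
      case True
      then obtain k where k: "p k \<noteq> 0" by blast
      have same: "H p' = H p" if "initial_segment p' (Suc k) = initial_segment p (Suc k)" for p'
      proof -
        have eq: "p' j = p j" if "j \<le> k" for j
          using that \<open>initial_segment p' _ = _\<close> by (simp add: initial_segment_eq_iff)
        have "pos p' = pos p" "pos p \<le> k"
          unfolding pos_def using Least_cong_up_to[of "\<lambda>p k. p k \<noteq> 0" p k p'] k eq by auto
        moreover have "\<exists>k. p' k \<noteq> 0" using k eq[of k] by (intro exI[of _ k]) simp
        ultimately show ?thesis using True eq[of "pos p"] by (simp add: H_def)
      qed
      show ?thesis
      proof (intro exI[of _ "Suc k"] allI impI, elim conjE)
        fix p' q' assume q': "H p' = Some q'"
          and p': "initial_segment p' (Suc k) = initial_segment p (Suc k)"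
        from same[OF p'] q q' show "q' n = q n" by simp
      qed
    next
      case False
      \<comment> \<open>A late switch is harmless: it occurs at a position beyond \<open>n\<close>
        and leads to a point that agrees with \<open>l\<close> up to that position.\<close>
      have "q' n = q n" if q': "H p' = Some q'" and eq: "initial_segment p' (Suc n) = initial_segment p (Suc n)" for p' q'
      proof (cases "\<exists>k. p' k \<noteq> 0")
        case True
        then have "p' (pos p') \<noteq> 0" unfolding pos_def by (rule LeastI_ex)
        moreover have "p' j = 0" if "j \<le> n" for j
          using eq False that by (simp add: initial_segment_eq_iff)
        ultimately have "n < pos p'" by (metis not_le)
        then have "z (p' (pos p') - 1) (pos p') n = l n"
          using z(2)[of "p' (pos p') - 1" "pos p'"] by (simp add: initial_segment_eq_iff)
        with True False q q' show ?thesis by (auto simp: H_def)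
      qed (use False q q' in \<open>auto simp: H_def\<close>)
      then show ?thesis by blast
    qed
  qed
  moreover have "continuous_partial K"
    unfolding continuous_partial_pair_iff
  proof (intro allI impI)
    fix p r q n assume q: "K (p, r) = Some q"
    then obtain k where k: "stop (p, r) k" by (auto simp: K_def split: if_splits)
    have same: "K (p', r') = K (p, r)"
      if p': "initial_segment p' (Suc k) = initial_segment p (Suc k)"
        and r': "initial_segment r' (Suc k) = initial_segment r (Suc k)" for p' r'
    proof -
      have eq: "p' j = p j" "initial_segment r' j = initial_segment r j" if "j \<le> k" for j
        using that p' initial_segment_antimono[OF r', of j] by (auto simp: initial_segment_eq_iff)
      then have st: "stop (p', r') j = stop (p, r) j" if "j \<le> k" for j
        using that by (simp add: stop_def)
      have "out (p', r') = out (p, r)" "out (p, r) \<le> k"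
        unfolding out_def using Least_cong_up_to[of stop "(p, r)" k "(p', r')"] k st by auto
      moreover have "\<exists>k. stop (p', r') k" using k st[of k] by auto
      ultimately show ?thesis using k eq[of "out (p, r)"] by (auto simp: K_def)
    qed
    show "\<exists>k. \<forall>p' r' q'. K (p', r') = Some q' \<and> initial_segment p' k = initial_segment p k \<and>
        initial_segment r' k = initial_segment r k \<longrightarrow> q' n = q n"
    proof (intro exI[of _ "Suc k"] allI impI, elim conjE)
      fix p' r' q' assume q': "K (p', r') = Some q'"
        and p': "initial_segment p' (Suc k) = initial_segment p (Suc k)"
        and r': "initial_segment r' (Suc k) = initial_segment r (Suc k)"
      from same[OF p' r'] q q' show "q' n = q n" by simp
    qed
  qed
  moreover have "reduces_via enum_rep nat_rep ACC_nat baire_rep baire_rep f H K"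
    unfolding reduces_via_baire_iff
  proof (intro allI impI, elim conjE)
    fix p U assume "enum_rep p = Some U" and "U \<in> mv_dom ACC_nat"
    then have U: "U = {n. \<exists>k. p k = Suc n}" "finite U" "card U \<le> 1" "ACC_nat U = - U"
      by (auto simp: enum_rep_def mv_dom_def ACC_nat_def split: if_splits)
    \<comment> \<open>\<open>H\<close> and \<open>K\<close> may react to different positions of
      \<open>p\<close>; since \<open>U\<close> has at most one element, they see the same listed
      number.\<close>
    have same: "p i = p j" if "p i \<noteq> 0" "p j \<noteq> 0" for i j
    proof -
      have "p i = Suc (p i - 1)" "p j = Suc (p j - 1)" using that by simp_all
      then have "p i - 1 \<in> U" "p j - 1 \<in> U" unfolding U(1) by blast+
      moreover have "\<forall>a\<in>U. \<forall>b\<in>U. a = b" using U(3) card_le_Suc0_iff_eq[OF U(2)] by simp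
      ultimately have "p i - 1 = p j - 1" by blast
      with that show ?thesis by simp
    qed
    define q where "q = the (H p)"
    have q: "H p = Some q" by (simp add: q_def H_def)
    have "q \<in> A" using z(1) A(1) by (auto simp: q_def H_def)
    have "\<exists>s. K (p, y) = Some s \<and> s 0 \<notin> U" if y: "y \<in> f q" for y
    proof -
      have "\<exists>k. stop (p, y) k"
      proof (cases "\<exists>k. p k \<noteq> 0")
        case False
        then have "q = l" by (simp add: q_def H_def)
        with bad_prefix y show ?thesis by (auto simp: stop_def)
      qed (auto simp: stop_def)
      then have st: "stop (p, y) (out (p, y))" unfolding out_def by (rule LeastI_ex)
      define k where "k = out (p, y)"
      define v where "v = (if p k \<noteq> 0 then p k else list_encode (initial_segment y k))"
      have "p j \<noteq> Suc v" for j
      proof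
        assume j: "p j = Suc v"
        show False
        proof (cases "p k = 0")
          case False
          with same[of j k] j show False by (simp add: v_def)
        next
          case True
          \<comment> \<open>If the code of the avoidable prefix were itself listed, \<open>H\<close>
            would have moved to a point at which no solution, hence not \<open>y\<close>, begins
            with that prefix.\<close>
          then have v: "list_decode v = initial_segment y k" by (simp add: v_def list_encode_inverse)
          have bad: "bad (list_decode v)" using st True unfolding v by (simp add: stop_def k_def)
          have ex: "\<exists>k. p k \<noteq> 0" using j by (intro exI[of _ j]) simp
          then have "p (pos p) \<noteq> 0" unfolding pos_def by (rule LeastI_ex)
          then have "p (pos p) = Suc v" using same[of j "pos p"] j by simp
          with ex have "q = z v (pos p)" by (simp add: q_def H_def)
          with y have "y \<in> f (z v (pos p))" by simp
          from z(3)[OF bad this] v show False by simp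
        qed
      qed
      then have "v \<notin> U" by (auto simp: U(1))
      with st show ?thesis by (auto simp: K_def v_def k_def)
    qed
    with q \<open>q \<in> A\<close> A(2) show "\<exists>q. H p = Some q \<and> q \<in> mv_dom f \<and>
        (\<forall>r y. baire_rep r = Some y \<and> y \<in> f q \<longrightarrow> (\<exists>s v. K (p, r) = Some s \<and> nat_rep s = Some v \<and> v \<in> ACC_nat U))"
      unfolding U(4) by (intro exI[of _ q]) (auto simp: baire_rep_def nat_rep_def)
  qed
  ultimately show ?thesis unfolding continuous_weihrauch_le_def by blast
qed

theorem theorem1:
  fixes f :: "(nat \<Rightarrow> nat, nat \<Rightarrow> nat) mvfun"
  shows "(\<not> mv_continuous baire_rep nat_rep (first_order_part f) \<longleftrightarrow>
           (\<exists>a :: nat \<Rightarrow> (nat \<Rightarrow> nat). convergent a \<and> closure (range a) \<subseteq> mv_dom f \<and>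
              \<not> mv_continuous baire_rep baire_rep (mv_restrict f (closure (range a)))))
       \<and> (\<not> mv_continuous baire_rep nat_rep (first_order_part f) \<longleftrightarrow>
           continuous_weihrauch_le enum_rep nat_rep ACC_nat baire_rep baire_rep f)"
  using discontinuous_first_order_part_imp_sequence[of f] discontinuous_sequence_imp_ACC_nat_le[of _ f]
    not_ACC_nat_le[of f] by blast

end
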